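(* Let $n\ge 3$ be an odd integer and $G=\langle\sigma,\tau:\sigma^n=\tau^2=1,\ \tau\sigma\tau^{-1}=\sigma^{-1}\rangle\simeq D_n$. Then there is an isomorphism of $G$-lattices $\widetilde{M}_+\oplus\widetilde{M}_-\simeq\mathbb{Z}[G]\oplus\mathbb{Z}[G/\langle\sigma\rangle]$.
   Context: $D_n$ is the dihedral group of order $2n$. A $G$-lattice is a finitely generated $\mathbb{Z}[G]$-module that is torsion-free as an abelian group; for a subgroup $S\le G$, $\mathbb{Z}[G/S]$ is the permutation lattice on the left cosets of $S$. The $G$-lattice $\widetilde{M}_+$ of rank $n+1$ is the free abelian group with basis $w_0,\ldots,w_{n-1},w$ (indices modulo $n$) and action $\sigma\cdot w_i=w_{i+1}$, $\tau\cdot w_i=w_{-i}$, $\sigma\cdot w=w$, $\tau\cdot w=-w+\sum_{0\le i\le n-1}w_i$. The $G$-lattice $\widetilde{M}_-$ of rank $n+1$ is the free abelian group with basis $w_0,\ldots,w_{n-1},w'$ (indices modulo $n$) and action $\sigma\cdot w_i=w_{i+1}$, $\tau\cdot w_i=-w_{-i}$, $\sigma\cdot w'=w'$, $\tau\cdot w'=w'-\sum_{0\le i\le n-1}w_i$. *)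

theory Defs
  imports "HOL-Algebra.Module" "HOL-Algebra.Left_Coset" "HOL-Algebra.Generated_Groups"
    "HOL-Library.Poly_Mapping"
begin

section \<open>The integral group ring and \<open>G\<close>-lattices\<close>

text \<open>The free abelian group on \<open>B\<close> is the set of all \<open>x :: 'b \<Rightarrow>\<^sub>0 int\<close> with
  \<open>Poly_Mapping.keys x \<subseteq> B\<close>; its basis vectors are \<open>frag_of b\<close> for \<open>b \<in> B\<close>, and \<open>frag_extend f\<close> is the
  additive map with \<open>frag_of b \<mapsto> f b\<close>.\<close>

definition int_group_ring :: "('g, 'm) monoid_scheme \<Rightarrow> ('g \<Rightarrow>\<^sub>0 int) ring" where
  "int_group_ring G =
     \<lparr>carrier = {a. Poly_Mapping.keys a \<subseteq> carrier G},
      mult = (\<lambda>a b. frag_extend (\<lambda>g. frag_extend (\<lambda>h. frag_of (g \<otimes>\<^bsub>G\<^esub> h)) b) a),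
      one = frag_of \<one>\<^bsub>G\<^esub>,
      zero = 0,
      add = (+)\<rparr>"

text \<open>The library locale \<open>module\<close> requires a commutative base ring. As there, the fields \<open>mult\<close> and
  \<open>one\<close> of the module record play no role.\<close>

locale left_module = R?: ring R + M?: abelian_group M
  for R :: "('a, 'r) ring_scheme" (structure) and M :: "('a, 'b, 'c) module_scheme" (structure) +
  assumes smult_closed [simp, intro]:
      "\<lbrakk>a \<in> carrier R; x \<in> carrier M\<rbrakk> \<Longrightarrow> a \<odot>\<^bsub>M\<^esub> x \<in> carrier M"
    and smult_l_distr:
      "\<lbrakk>a \<in> carrier R; b \<in> carrier R; x \<in> carrier M\<rbrakk> \<Longrightarrow>
        (a \<oplus>\<^bsub>R\<^esub> b) \<odot>\<^bsub>M\<^esub> x = a \<odot>\<^bsub>M\<^esub> x \<oplus>\<^bsub>M\<^esub> b \<odot>\<^bsub>M\<^esub> x"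
    and smult_r_distr:
      "\<lbrakk>a \<in> carrier R; x \<in> carrier M; y \<in> carrier M\<rbrakk> \<Longrightarrow>
        a \<odot>\<^bsub>M\<^esub> (x \<oplus>\<^bsub>M\<^esub> y) = a \<odot>\<^bsub>M\<^esub> x \<oplus>\<^bsub>M\<^esub> a \<odot>\<^bsub>M\<^esub> y"
    and smult_assoc1:
      "\<lbrakk>a \<in> carrier R; b \<in> carrier R; x \<in> carrier M\<rbrakk> \<Longrightarrow>
        (a \<otimes>\<^bsub>R\<^esub> b) \<odot>\<^bsub>M\<^esub> x = a \<odot>\<^bsub>M\<^esub> (b \<odot>\<^bsub>M\<^esub> x)"
    and smult_one [simp]: "x \<in> carrier M \<Longrightarrow> \<one>\<^bsub>R\<^esub> \<odot>\<^bsub>M\<^esub> x = x"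

definition fin_gen_module :: "('a, 'r) ring_scheme \<Rightarrow> ('a, 'b, 'c) module_scheme \<Rightarrow> bool" where
  "fin_gen_module R M \<longleftrightarrow>
     (\<exists>S. finite S \<and> S \<subseteq> carrier M \<and> (\<forall>H. submodule H R M \<and> S \<subseteq> H \<longrightarrow> H = carrier M))"

definition add_torsion_free :: "('b, 'c) ring_scheme \<Rightarrow> bool" where
  "add_torsion_free M \<longleftrightarrow>
     (\<forall>x\<in>carrier M. \<forall>k::nat. k > 0 \<and> [k] \<cdot>\<^bsub>M\<^esub> x = \<zero>\<^bsub>M\<^esub> \<longrightarrow> x = \<zero>\<^bsub>M\<^esub>)"

definition G_lattice :: "('g, 'm) monoid_scheme \<Rightarrow> ('g \<Rightarrow>\<^sub>0 int, 'b, 'c) module_scheme \<Rightarrow> bool" where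
  "G_lattice G M \<longleftrightarrow> left_module (int_group_ring G) M \<and> fin_gen_module (int_group_ring G) M \<and>
     add_torsion_free M"

definition left_module_hom ::
  "('a, 'r) ring_scheme \<Rightarrow> ('a, 'b, 'c) module_scheme \<Rightarrow> ('a, 'd, 'e) module_scheme \<Rightarrow> ('b \<Rightarrow> 'd) set"
  where
  "left_module_hom R M N =
     {f \<in> carrier M \<rightarrow> carrier N.
        (\<forall>x\<in>carrier M. \<forall>y\<in>carrier M. f (x \<oplus>\<^bsub>M\<^esub> y) = f x \<oplus>\<^bsub>N\<^esub> f y) \<and>
        (\<forall>a\<in>carrier R. \<forall>x\<in>carrier M. f (a \<odot>\<^bsub>M\<^esub> x) = a \<odot>\<^bsub>N\<^esub> f x)}"

definition G_lattice_iso ::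
  "('g, 'm) monoid_scheme \<Rightarrow> ('g \<Rightarrow>\<^sub>0 int, 'b, 'c) module_scheme \<Rightarrow>
   ('g \<Rightarrow>\<^sub>0 int, 'd, 'e) module_scheme \<Rightarrow> bool" where
  "G_lattice_iso G M N \<longleftrightarrow> G_lattice G M \<and> G_lattice G N \<and>
     (\<exists>f \<in> left_module_hom (int_group_ring G) M N. bij_betw f (carrier M) (carrier N))"

definition module_sum ::
  "('a, 'b, 'c) module_scheme \<Rightarrow> ('a, 'd, 'e) module_scheme \<Rightarrow> ('a, 'b \<times> 'd) module"
  (infixr \<open>\<oplus>\<^sub>L\<close> 65) where
  "M \<oplus>\<^sub>L N =
     \<lparr>carrier = carrier M \<times> carrier N,
      mult = undefined, one = undefined,
      zero = (\<zero>\<^bsub>M\<^esub>, \<zero>\<^bsub>N\<^esub>),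
      add = (\<lambda>(x, y) (x', y'). (x \<oplus>\<^bsub>M\<^esub> x', y \<oplus>\<^bsub>N\<^esub> y')),
      smult = (\<lambda>a (x, y). (a \<odot>\<^bsub>M\<^esub> x, a \<odot>\<^bsub>N\<^esub> y))\<rparr>"

text \<open>The free abelian group on \<open>B\<close> with \<open>g \<in> G\<close> acting as the additive map \<open>\<rho> g\<close>.\<close>

definition rep_module ::
  "'b set \<Rightarrow> ('g \<Rightarrow> ('b \<Rightarrow>\<^sub>0 int) \<Rightarrow> ('b \<Rightarrow>\<^sub>0 int)) \<Rightarrow> ('g \<Rightarrow>\<^sub>0 int, 'b \<Rightarrow>\<^sub>0 int) module" where
  "rep_module B \<rho> =
     \<lparr>carrier = {x. Poly_Mapping.keys x \<subseteq> B},
      mult = undefined, one = undefined,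
      zero = 0,
      add = (+),
      smult = (\<lambda>a x. frag_extend (\<lambda>g. \<rho> g x) a)\<rparr>"

definition regular_lattice :: "('g, 'm) monoid_scheme \<Rightarrow> ('g \<Rightarrow>\<^sub>0 int, 'g \<Rightarrow>\<^sub>0 int) module" where
  "regular_lattice G = rep_module (carrier G) (\<lambda>g. frag_extend (\<lambda>h. frag_of (g \<otimes>\<^bsub>G\<^esub> h)))"

definition perm_lattice ::
  "('g, 'm) monoid_scheme \<Rightarrow> 'g set \<Rightarrow> ('g \<Rightarrow>\<^sub>0 int, 'g set \<Rightarrow>\<^sub>0 int) module" where
  "perm_lattice G S =
     rep_module (lcosets\<^bsub>G\<^esub> S) (\<lambda>g. frag_extend (\<lambda>C. frag_of (g <#\<^bsub>G\<^esub> C)))"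


section \<open>The dihedral group and its lattices \<open>M\<^sub>+\<close> and \<open>M\<^sub>-\<close>\<close>

text \<open>The cardinality condition excludes the proper quotients of the group presented by these
  generators and relations, which is the dihedral group of order \<open>2n\<close>.\<close>

locale dihedral_group = group G for G :: "('g, 'm) monoid_scheme" (structure) +
  fixes n :: nat and \<sigma> \<tau> :: 'g
  assumes sigma_closed [simp, intro]: "\<sigma> \<in> carrier G"
    and tau_closed [simp, intro]: "\<tau> \<in> carrier G"
    and generated: "generate G {\<sigma>, \<tau>} = carrier G"
    and sigma_pow_n: "\<sigma> [^] n = \<one>"
    and tau_pow_2: "\<tau> [^] (2::nat) = \<one>"
    and tau_conj: "\<tau> \<otimes> \<sigma> \<otimes> inv \<tau> = inv \<sigma>"
    and order_eq: "order G = 2 * n"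

text \<open>\<open>(i, e)\<close> with \<open>g = \<sigma>\<^sup>i \<tau>\<^sup>e\<close>, \<open>0 \<le> i < n\<close> and \<open>0 \<le> e < 2\<close>.\<close>

definition dihedral_exps :: "('g, 'm) monoid_scheme \<Rightarrow> nat \<Rightarrow> 'g \<Rightarrow> 'g \<Rightarrow> 'g \<Rightarrow> nat \<times> nat" where
  "dihedral_exps G n \<sigma> \<tau> g =
     (THE p. fst p < n \<and> snd p < 2 \<and> g = \<sigma> [^]\<^bsub>G\<^esub> fst p \<otimes>\<^bsub>G\<^esub> \<tau> [^]\<^bsub>G\<^esub> snd p)"

text \<open>The action of \<open>G\<close> for which \<open>\<sigma>\<close> acts as \<open>s\<close> and \<open>\<tau>\<close> as \<open>t\<close>, provided \<open>s\<close> and \<open>t\<close> satisfy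
  the defining relations.\<close>

definition dihedral_rep ::
  "('g, 'm) monoid_scheme \<Rightarrow> nat \<Rightarrow> 'g \<Rightarrow> 'g \<Rightarrow> ('x \<Rightarrow> 'x) \<Rightarrow> ('x \<Rightarrow> 'x) \<Rightarrow> 'g \<Rightarrow> 'x \<Rightarrow> 'x" where
  "dihedral_rep G n \<sigma> \<tau> s t g =
     (s ^^ fst (dihedral_exps G n \<sigma> \<tau> g)) \<circ> (t ^^ snd (dihedral_exps G n \<sigma> \<tau> g))"

text \<open>\<open>W i\<close> is the index of \<open>w\<^sub>i\<close> (\<open>0 \<le> i < n\<close>), and \<open>W_last\<close> that of \<open>w\<close>, respectively \<open>w'\<close>.\<close>

datatype M_index = W int | W_last

definition M_basis :: "nat \<Rightarrow> M_index set" where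
  "M_basis n = insert W_last (W ` {0..<int n})"

definition M_sigma :: "nat \<Rightarrow> (M_index \<Rightarrow>\<^sub>0 int) \<Rightarrow> (M_index \<Rightarrow>\<^sub>0 int)" where
  "M_sigma n = frag_extend (\<lambda>b. case b of
       W i \<Rightarrow> frag_of (W ((i + 1) mod int n))
     | W_last \<Rightarrow> frag_of W_last)"

definition M_plus_tau :: "nat \<Rightarrow> (M_index \<Rightarrow>\<^sub>0 int) \<Rightarrow> (M_index \<Rightarrow>\<^sub>0 int)" where
  "M_plus_tau n = frag_extend (\<lambda>b. case b of
       W i \<Rightarrow> frag_of (W ((- i) mod int n))
     | W_last \<Rightarrow> - frag_of W_last + (\<Sum>i\<in>{0..<int n}. frag_of (W i)))"

definition M_minus_tau :: "nat \<Rightarrow> (M_index \<Rightarrow>\<^sub>0 int) \<Rightarrow> (M_index \<Rightarrow>\<^sub>0 int)" where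
  "M_minus_tau n = frag_extend (\<lambda>b. case b of
       W i \<Rightarrow> - frag_of (W ((- i) mod int n))
     | W_last \<Rightarrow> frag_of W_last - (\<Sum>i\<in>{0..<int n}. frag_of (W i)))"

definition M_plus ::
  "('g, 'm) monoid_scheme \<Rightarrow> nat \<Rightarrow> 'g \<Rightarrow> 'g \<Rightarrow> ('g \<Rightarrow>\<^sub>0 int, M_index \<Rightarrow>\<^sub>0 int) module" where
  "M_plus G n \<sigma> \<tau> = rep_module (M_basis n) (dihedral_rep G n \<sigma> \<tau> (M_sigma n) (M_plus_tau n))"

definition M_minus ::
  "('g, 'm) monoid_scheme \<Rightarrow> nat \<Rightarrow> 'g \<Rightarrow> 'g \<Rightarrow> ('g \<Rightarrow>\<^sub>0 int, M_index \<Rightarrow>\<^sub>0 int) module" where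
  "M_minus G n \<sigma> \<tau> = rep_module (M_basis n) (dihedral_rep G n \<sigma> \<tau> (M_sigma n) (M_minus_tau n))"

section \<open>These are \<open>G\<close>-lattices\<close>

lemma frag_add_eqI:
  fixes f g :: "('b \<Rightarrow>\<^sub>0 int) \<Rightarrow> ('c \<Rightarrow>\<^sub>0 int)"
  assumes "\<And>x y. f (x - y) = f x - f y" and "\<And>x y. g (x - y) = g x - g y"
    and "\<And>b. b \<in> B \<Longrightarrow> f (frag_of b) = g (frag_of b)" and "Poly_Mapping.keys x \<subseteq> B"
  shows "f x = g x"
  using assms(4)
proof (induction x rule: frag_induction)
  case zero
  show ?case using assms(1)[of 0 0] assms(2)[of 0 0] by simp
next
  case (one b)
  then show ?case by (rule assms(3))
next
  case (diff x y)
  then show ?case by (simp add: assms(1,2))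
qed

lemma frag_extend_fun_add:
  "frag_extend (\<lambda>g. f g + h g) a = frag_extend f a + frag_extend h a"
  by (simp add: frag_extend_def sum.distrib frag_cmul_distrib2)

lemma keys_frag_extend_subset:
  assumes "\<And>b. b \<in> A \<Longrightarrow> Poly_Mapping.keys (f b) \<subseteq> B" and "Poly_Mapping.keys x \<subseteq> A"
  shows "Poly_Mapping.keys (frag_extend f x) \<subseteq> B"
  using keys_frag_extend[of f x] assms by blast

lemma add_funs_extend:
  fixes L :: "('b \<Rightarrow>\<^sub>0 int) \<Rightarrow> ('c \<Rightarrow>\<^sub>0 int)"
  assumes "\<And>x y. L (x - y) = L x - L y"
  shows "L (frag_extend f a) = frag_extend (\<lambda>b. L (f b)) a"
  by (rule frag_add_eqI[where B = UNIV and f = "\<lambda>a. L (frag_extend f a)"])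
     (simp_all add: assms frag_extend_diff)

definition add_rep ::
  "('g, 'm) monoid_scheme \<Rightarrow> 'b set \<Rightarrow> ('g \<Rightarrow> ('b \<Rightarrow>\<^sub>0 int) \<Rightarrow> ('b \<Rightarrow>\<^sub>0 int)) \<Rightarrow> bool" where
  "add_rep G B \<rho> \<longleftrightarrow>
     (\<forall>g\<in>carrier G. \<forall>x y. \<rho> g (x - y) = \<rho> g x - \<rho> g y) \<and>
     (\<forall>g\<in>carrier G. \<forall>x. Poly_Mapping.keys x \<subseteq> B \<longrightarrow> Poly_Mapping.keys (\<rho> g x) \<subseteq> B) \<and>
     (\<forall>x. Poly_Mapping.keys x \<subseteq> B \<longrightarrow> \<rho> \<one>\<^bsub>G\<^esub> x = x) \<and>
     (\<forall>g\<in>carrier G. \<forall>h\<in>carrier G. \<forall>x. Poly_Mapping.keys x \<subseteq> B \<longrightarrow> \<rho> (g \<otimes>\<^bsub>G\<^esub> h) x = \<rho> g (\<rho> h x))"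

lemma frag_abelian_group:
  fixes M :: "('b \<Rightarrow>\<^sub>0 int, 'r) ring_scheme"
  assumes "carrier M = {x. Poly_Mapping.keys x \<subseteq> B}" and "add M = (+)" and "zero M = 0"
  shows "abelian_group M"
proof (rule abelian_groupI)
  show "\<exists>y\<in>carrier M. y \<oplus>\<^bsub>M\<^esub> x = \<zero>\<^bsub>M\<^esub>" if "x \<in> carrier M" for x
    using that by (intro bexI[of _ "- x"]) (auto simp: assms)
qed (use assms in \<open>auto simp: ac_simps dest!: subsetD[OF Poly_Mapping.keys_add]\<close>)

lemma (in group) group_ring_mult_rep:
  assumes "add_rep G B \<rho>" and "Poly_Mapping.keys a \<subseteq> carrier G" "Poly_Mapping.keys b \<subseteq> carrier G"
    and "Poly_Mapping.keys x \<subseteq> B"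
  shows "frag_extend (\<lambda>g. \<rho> g x) (frag_extend (\<lambda>g. frag_extend (\<lambda>h. frag_of (g \<otimes> h)) b) a) =
     frag_extend (\<lambda>g. \<rho> g (frag_extend (\<lambda>h. \<rho> h x) b)) a"
proof -
  have "frag_extend (\<lambda>g. \<rho> g x) (frag_extend (\<lambda>h. frag_of (g \<otimes> h)) b) =
     \<rho> g (frag_extend (\<lambda>h. \<rho> h x) b)" if g: "g \<in> carrier G" for g
  proof (rule frag_add_eqI[where B = "carrier G"])
    show "frag_extend (\<lambda>g. \<rho> g x) (frag_extend (\<lambda>h. frag_of (g \<otimes> h)) (frag_of h)) =
       \<rho> g (frag_extend (\<lambda>h. \<rho> h x) (frag_of h))" if "h \<in> carrier G" for h
      using assms that g by (simp add: add_rep_def)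
  qed (use assms g in \<open>auto simp: frag_extend_diff add_rep_def\<close>)
  then show ?thesis
    using assms(2)
    by (subst add_funs_extend) (auto simp: frag_extend_diff intro!: frag_extend_eq)
qed

lemma (in group) add_rep_regular:
  "add_rep G (carrier G) (\<lambda>g. frag_extend (\<lambda>h. frag_of (g \<otimes> h)))"
  unfolding add_rep_def
proof (intro conjI ballI allI impI)
  fix g and x :: "'a \<Rightarrow>\<^sub>0 int" assume "g \<in> carrier G" "Poly_Mapping.keys x \<subseteq> carrier G"
  then show "Poly_Mapping.keys (frag_extend (\<lambda>h. frag_of (g \<otimes> h)) x) \<subseteq> carrier G"
    by (intro keys_frag_extend_subset) auto
next
  fix x :: "'a \<Rightarrow>\<^sub>0 int" assume x: "Poly_Mapping.keys x \<subseteq> carrier G"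
  show "frag_extend (\<lambda>h. frag_of (\<one> \<otimes> h)) x = x"
    by (rule frag_add_eqI[where B = "carrier G" and g = "\<lambda>x. x", OF _ _ _ x])
       (simp_all add: frag_extend_diff)
next
  fix g h and x :: "'a \<Rightarrow>\<^sub>0 int"
  assume g: "g \<in> carrier G" "h \<in> carrier G" and x: "Poly_Mapping.keys x \<subseteq> carrier G"
  show "frag_extend (\<lambda>k. frag_of (g \<otimes> h \<otimes> k)) x =
      frag_extend (\<lambda>h. frag_of (g \<otimes> h)) (frag_extend (\<lambda>k. frag_of (h \<otimes> k)) x)"
    by (rule frag_add_eqI[where B = "carrier G", OF _ _ _ x]) (simp_all add: frag_extend_diff m_assoc g)
qed (simp add: frag_extend_diff)

lemma (in group) add_rep_extend_closed:
  assumes "add_rep G B \<rho>" "Poly_Mapping.keys a \<subseteq> carrier G" "Poly_Mapping.keys x \<subseteq> B"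
  shows "Poly_Mapping.keys (frag_extend (\<lambda>g. \<rho> g x) a) \<subseteq> B"
  using assms by (intro keys_frag_extend_subset[where A = "carrier G"]) (auto simp: add_rep_def)

lemma add_rep_add:
  assumes "add_rep G B \<rho>" "g \<in> carrier G"
  shows "\<rho> g (x + y) = \<rho> g x + \<rho> g y"
proof -
  have d: "\<rho> g (x - y) = \<rho> g x - \<rho> g y" for x y
    using assms by (simp add: add_rep_def)
  have "\<rho> g (- y) = - \<rho> g y"
    using d[of 0 0] d[of 0 y] by simp
  then show ?thesis using d[of x "- y"] by simp
qed

lemma (in group) add_rep_extend_add:
  assumes "add_rep G B \<rho>" "Poly_Mapping.keys a \<subseteq> carrier G"
  shows "frag_extend (\<lambda>g. \<rho> g (x + y)) a =
    frag_extend (\<lambda>g. \<rho> g x) a + frag_extend (\<lambda>g. \<rho> g y) a"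
  unfolding frag_extend_fun_add[symmetric]
  using assms by (intro frag_extend_eq) (auto simp: add_rep_add)

lemma (in group) ring_int_group_ring: "ring (int_group_ring G)"
proof (rule ringI)
  note reg = add_rep_regular
  let ?R = "int_group_ring G"
  show "abelian_group ?R"
    by (rule frag_abelian_group[where B = "carrier G"]) (auto simp: int_group_ring_def)
  show "monoid ?R"
  proof (rule monoidI)
    show "x \<otimes>\<^bsub>?R\<^esub> y \<in> carrier ?R" if "x \<in> carrier ?R" "y \<in> carrier ?R" for x y
      using that add_rep_extend_closed[OF reg, of x y] by (simp add: int_group_ring_def)
    show "\<one>\<^bsub>?R\<^esub> \<in> carrier ?R" by (simp add: int_group_ring_def)
    show "x \<otimes>\<^bsub>?R\<^esub> y \<otimes>\<^bsub>?R\<^esub> z = x \<otimes>\<^bsub>?R\<^esub> (y \<otimes>\<^bsub>?R\<^esub> z)"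
      if "x \<in> carrier ?R" "y \<in> carrier ?R" "z \<in> carrier ?R" for x y z
      using that group_ring_mult_rep[OF reg, of x y z] by (simp add: int_group_ring_def)
    show "\<one>\<^bsub>?R\<^esub> \<otimes>\<^bsub>?R\<^esub> x = x" if "x \<in> carrier ?R" for x
      using that reg by (simp add: int_group_ring_def add_rep_def)
    show "x \<otimes>\<^bsub>?R\<^esub> \<one>\<^bsub>?R\<^esub> = x" if "x \<in> carrier ?R" for x
    proof -
      have x: "Poly_Mapping.keys x \<subseteq> carrier G" using that by (simp add: int_group_ring_def)
      have "frag_extend (\<lambda>g. frag_of (g \<otimes> \<one>)) x = x"
        by (rule frag_add_eqI[where B = "carrier G" and g = "\<lambda>x. x", OF _ _ _ x])
           (simp_all add: frag_extend_diff)
      then show ?thesis by (simp add: int_group_ring_def)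
    qed
  qed
  show "(x \<oplus>\<^bsub>?R\<^esub> y) \<otimes>\<^bsub>?R\<^esub> z = x \<otimes>\<^bsub>?R\<^esub> z \<oplus>\<^bsub>?R\<^esub> y \<otimes>\<^bsub>?R\<^esub> z" for x y z
    by (simp add: int_group_ring_def frag_extend_add)
  show "z \<otimes>\<^bsub>?R\<^esub> (x \<oplus>\<^bsub>?R\<^esub> y) = z \<otimes>\<^bsub>?R\<^esub> x \<oplus>\<^bsub>?R\<^esub> z \<otimes>\<^bsub>?R\<^esub> y" for x y z
    by (simp add: int_group_ring_def frag_extend_add frag_extend_fun_add)
qed

lemma (in group) left_module_rep_module:
  assumes "add_rep G B \<rho>"
  shows "left_module (int_group_ring G) (rep_module B \<rho>)"
proof -
  let ?R = "int_group_ring G" and ?M = "rep_module B \<rho>"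
  interpret R: ring ?R by (rule ring_int_group_ring)
  interpret M: abelian_group ?M
    by (rule frag_abelian_group[where B = B]) (auto simp: rep_module_def)
  show ?thesis
  proof
    show "a \<odot>\<^bsub>?M\<^esub> x \<in> carrier ?M" if "a \<in> carrier ?R" "x \<in> carrier ?M" for a x
      using that add_rep_extend_closed[OF assms, of a x]
      by (simp add: int_group_ring_def rep_module_def)
    show "(a \<oplus>\<^bsub>?R\<^esub> b) \<odot>\<^bsub>?M\<^esub> x = a \<odot>\<^bsub>?M\<^esub> x \<oplus>\<^bsub>?M\<^esub> b \<odot>\<^bsub>?M\<^esub> x" for a b x
      by (simp add: int_group_ring_def rep_module_def frag_extend_add)
    show "a \<odot>\<^bsub>?M\<^esub> (x \<oplus>\<^bsub>?M\<^esub> y) = a \<odot>\<^bsub>?M\<^esub> x \<oplus>\<^bsub>?M\<^esub> a \<odot>\<^bsub>?M\<^esub> y" if "a \<in> carrier ?R" for a x y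
      using that add_rep_extend_add[OF assms, of a]
      by (simp add: int_group_ring_def rep_module_def)
    show "(a \<otimes>\<^bsub>?R\<^esub> b) \<odot>\<^bsub>?M\<^esub> x = a \<odot>\<^bsub>?M\<^esub> (b \<odot>\<^bsub>?M\<^esub> x)"
      if "a \<in> carrier ?R" "b \<in> carrier ?R" "x \<in> carrier ?M" for a b x
      using that group_ring_mult_rep[OF assms, of a b x]
      by (simp add: int_group_ring_def rep_module_def)
    show "\<one>\<^bsub>?R\<^esub> \<odot>\<^bsub>?M\<^esub> x = x" if "x \<in> carrier ?M" for x
      using that assms by (simp add: int_group_ring_def rep_module_def add_rep_def)
  qed
qed

lemma submodule_rep_module_eq:
  assumes "submodule H R (rep_module B \<rho>)" and "frag_of ` B \<subseteq> H"
  shows "H = carrier (rep_module B \<rho>)"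
proof
  let ?M = "rep_module B \<rho>"
  have ab: "abelian_group ?M"
    by (rule frag_abelian_group[where B = B]) (auto simp: rep_module_def)
  interpret H: subgroup H "add_monoid ?M"
    using assms(1) by (rule submodule.axioms)
  interpret M: abelian_group ?M by fact
  show "H \<subseteq> carrier ?M" using H.subset by simp
  have sub: "x - y \<in> H" if "x \<in> H" "y \<in> H" for x y
  proof -
    have y: "y \<in> carrier ?M" using that H.subset by auto
    then have my: "- y \<in> carrier ?M" by (simp add: rep_module_def)
    have "inv\<^bsub>add_monoid ?M\<^esub> y = - y"
      using y my M.add.inv_equality[of "- y" y] by (simp add: rep_module_def a_inv_def)
    then show ?thesis
      using H.m_closed[OF that(1) H.m_inv_closed[OF that(2)]] by (simp add: rep_module_def)
  qed
  show "carrier ?M \<subseteq> H"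
  proof
    fix x assume "x \<in> carrier ?M"
    then have "Poly_Mapping.keys x \<subseteq> B" by (simp add: rep_module_def)
    then show "x \<in> H"
    proof (induction x rule: frag_induction)
      case zero show ?case using H.one_closed by (simp add: rep_module_def)
    next
      case (one b) then show ?case using assms(2) by blast
    next
      case (diff x y) then show ?case by (simp add: sub)
    qed
  qed
qed

lemma (in group) G_lattice_rep_module:
  assumes "add_rep G B \<rho>" and "finite B"
  shows "G_lattice G (rep_module B \<rho>)"
  unfolding G_lattice_def
proof (intro conjI)
  let ?M = "rep_module B \<rho>"
  show "left_module (int_group_ring G) ?M" by (rule left_module_rep_module) fact
  show "fin_gen_module (int_group_ring G) ?M"
    unfolding fin_gen_module_def using assms(2)
    by (intro exI[of _ "frag_of ` B"])
       (use submodule_rep_module_eq in \<open>force simp: rep_module_def[of B \<rho>, THEN arg_cong[where f = carrier]]\<close>)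
  have "[k] \<cdot>\<^bsub>?M\<^esub> x = frag_cmul (int k) x" for k :: nat and x
    by (induction k) (simp_all add: add_pow_def rep_module_def frag_cmul_distrib nat_pow_def add.commute)
  moreover have "\<zero>\<^bsub>?M\<^esub> = 0" by (simp add: rep_module_def)
  ultimately show "add_torsion_free ?M"
    by (auto simp: add_torsion_free_def)
qed

lemma (in group) G_lattice_regular:
  assumes "finite (carrier G)"
  shows "G_lattice G (regular_lattice G)"
  unfolding regular_lattice_def by (rule G_lattice_rep_module) (auto simp: add_rep_regular assms)

lemma (in group) G_lattice_perm:
  assumes "finite (carrier G)" and "subgroup S G"
  shows "G_lattice G (perm_lattice G S)"
  unfolding perm_lattice_def
proof (rule G_lattice_rep_module)
  have S: "S \<subseteq> carrier G" using assms(2) by (rule subgroup.subset)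
  show "finite (lcosets S)" using assms(1) by (simp add: LCOSETS_def)
  have cl: "g <# C \<in> lcosets S" if "g \<in> carrier G" "C \<in> lcosets S" for g C
    using that S by (auto simp: LCOSETS_def lcos_m_assoc)
  have as: "g \<otimes> h <# C = g <# (h <# C)" if "g \<in> carrier G" "h \<in> carrier G" "C \<in> lcosets S" for g h C
    using that S by (auto simp: LCOSETS_def lcos_m_assoc m_assoc)
  have one: "\<one> <# C = C" if "C \<in> lcosets S" for C
    using that S by (auto simp: LCOSETS_def lcos_m_assoc)
  show "add_rep G (lcosets S) (\<lambda>g. frag_extend (\<lambda>C. frag_of (g <# C)))"
    unfolding add_rep_def
  proof (intro conjI ballI allI impI)
    fix g and x :: "'a set \<Rightarrow>\<^sub>0 int" assume "g \<in> carrier G" "Poly_Mapping.keys x \<subseteq> lcosets S"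
    then show "Poly_Mapping.keys (frag_extend (\<lambda>C. frag_of (g <# C)) x) \<subseteq> lcosets S"
      using cl by (intro keys_frag_extend_subset) auto
  next
    fix x :: "'a set \<Rightarrow>\<^sub>0 int" assume x: "Poly_Mapping.keys x \<subseteq> lcosets S"
    show "frag_extend (\<lambda>C. frag_of (\<one> <# C)) x = x"
      by (rule frag_add_eqI[where B = "lcosets S" and g = "\<lambda>x. x", OF _ _ _ x])
         (simp_all add: frag_extend_diff one)
  next
    fix g h and x :: "'a set \<Rightarrow>\<^sub>0 int"
    assume g: "g \<in> carrier G" "h \<in> carrier G" and x: "Poly_Mapping.keys x \<subseteq> lcosets S"
    show "frag_extend (\<lambda>C. frag_of (g \<otimes> h <# C)) x =
        frag_extend (\<lambda>C. frag_of (g <# C)) (frag_extend (\<lambda>C. frag_of (h <# C)) x)"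
      by (rule frag_add_eqI[where B = "lcosets S", OF _ _ _ x]) (simp_all add: frag_extend_diff as g)
  qed (simp add: frag_extend_diff)
qed

lemma abelian_group_module_sum:
  assumes "abelian_group M" "abelian_group N"
  shows "abelian_group (M \<oplus>\<^sub>L N)"
proof -
  interpret M: abelian_group M by fact
  interpret N: abelian_group N by fact
  show ?thesis
  proof (rule abelian_groupI)
    show "\<exists>y\<in>carrier (M \<oplus>\<^sub>L N). y \<oplus>\<^bsub>M \<oplus>\<^sub>L N\<^esub> x = \<zero>\<^bsub>M \<oplus>\<^sub>L N\<^esub>" if "x \<in> carrier (M \<oplus>\<^sub>L N)" for x
      using that
      by (intro bexI[of _ "(\<ominus>\<^bsub>M\<^esub> fst x, \<ominus>\<^bsub>N\<^esub> snd x)"]) (auto simp: module_sum_def M.l_neg N.l_neg)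
  qed (auto simp: module_sum_def M.a_ac N.a_ac)
qed

lemma left_module_module_sum:
  assumes "left_module R M" "left_module R N"
  shows "left_module R (M \<oplus>\<^sub>L N)"
proof -
  interpret M: left_module R M by fact
  interpret N: left_module R N by fact
  interpret S: abelian_group "M \<oplus>\<^sub>L N"
    by (rule abelian_group_module_sum) (rule M.M.abelian_group_axioms N.M.abelian_group_axioms)+
  show ?thesis
    by unfold_locales
       (auto simp: module_sum_def M.smult_l_distr N.smult_l_distr M.smult_r_distr N.smult_r_distr
          M.smult_assoc1 N.smult_assoc1)
qed

lemma add_pow_module_sum:
  fixes k :: nat
  shows "[k] \<cdot>\<^bsub>M \<oplus>\<^sub>L N\<^esub> (x, y) = ([k] \<cdot>\<^bsub>M\<^esub> x, [k] \<cdot>\<^bsub>N\<^esub> y)"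
  by (induction k) (simp_all add: add_pow_def nat_pow_def module_sum_def)

lemma fin_gen_module_sum:
  assumes "left_module R M" "left_module R N" "fin_gen_module R M" "fin_gen_module R N"
  shows "fin_gen_module R (M \<oplus>\<^sub>L N)"
proof -
  interpret M: left_module R M by fact
  interpret N: left_module R N by fact
  interpret MN: left_module R "M \<oplus>\<^sub>L N" by (rule left_module_module_sum) fact+
  obtain S where S': "finite S \<and> S \<subseteq> carrier M \<and>
      (\<forall>H. submodule H R M \<and> S \<subseteq> H \<longrightarrow> H = carrier M)"
    using assms(3)[unfolded fin_gen_module_def] by (rule exE)
  then have S: "finite S" "S \<subseteq> carrier M"
    "\<And>H. submodule H R M \<Longrightarrow> S \<subseteq> H \<Longrightarrow> H = carrier M"
    by simp_all
  obtain T where T': "finite T \<and> T \<subseteq> carrier N \<and>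
      (\<forall>H. submodule H R N \<and> T \<subseteq> H \<longrightarrow> H = carrier N)"
    using assms(4)[unfolded fin_gen_module_def] by (rule exE)
  then have T: "finite T" "T \<subseteq> carrier N"
    "\<And>H. submodule H R N \<Longrightarrow> T \<subseteq> H \<Longrightarrow> H = carrier N"
    by simp_all
  have Msm: "a \<odot>\<^bsub>M\<^esub> \<zero>\<^bsub>M\<^esub> = \<zero>\<^bsub>M\<^esub>" if a: "a \<in> carrier R" for a
  proof -
    have "a \<odot>\<^bsub>M\<^esub> \<zero>\<^bsub>M\<^esub> \<oplus>\<^bsub>M\<^esub> a \<odot>\<^bsub>M\<^esub> \<zero>\<^bsub>M\<^esub> = a \<odot>\<^bsub>M\<^esub> \<zero>\<^bsub>M\<^esub>"
      using M.smult_r_distr[OF a, of "\<zero>\<^bsub>M\<^esub>" "\<zero>\<^bsub>M\<^esub>"] by simp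
    then show ?thesis using a by simp
  qed
  have Nsm: "a \<odot>\<^bsub>N\<^esub> \<zero>\<^bsub>N\<^esub> = \<zero>\<^bsub>N\<^esub>" if a: "a \<in> carrier R" for a
  proof -
    have "a \<odot>\<^bsub>N\<^esub> \<zero>\<^bsub>N\<^esub> \<oplus>\<^bsub>N\<^esub> a \<odot>\<^bsub>N\<^esub> \<zero>\<^bsub>N\<^esub> = a \<odot>\<^bsub>N\<^esub> \<zero>\<^bsub>N\<^esub>"
      using N.smult_r_distr[OF a, of "\<zero>\<^bsub>N\<^esub>" "\<zero>\<^bsub>N\<^esub>"] by simp
    then show ?thesis using a by simp
  qed
  have M0: "\<ominus>\<^bsub>M\<^esub> \<zero>\<^bsub>M\<^esub> = \<zero>\<^bsub>M\<^esub>" and N0: "\<ominus>\<^bsub>N\<^esub> \<zero>\<^bsub>N\<^esub> = \<zero>\<^bsub>N\<^esub>"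
    using M.M.add.inv_one N.M.add.inv_one by (simp_all add: a_inv_def)
  let ?S = "S \<times> {\<zero>\<^bsub>N\<^esub>} \<union> {\<zero>\<^bsub>M\<^esub>} \<times> T"
  have "H = carrier (M \<oplus>\<^sub>L N)" if H: "submodule H R (M \<oplus>\<^sub>L N)" "?S \<subseteq> H" for H
  proof -
    interpret H: submodule H R "M \<oplus>\<^sub>L N" by fact
    have neg: "inv\<^bsub>add_monoid (M \<oplus>\<^sub>L N)\<^esub> (x, y) = (\<ominus>\<^bsub>M\<^esub> x, \<ominus>\<^bsub>N\<^esub> y)"
      if "x \<in> carrier M" "y \<in> carrier N" for x y
      using that
      by (intro MN.M.add.inv_equality[unfolded a_inv_def])
         (auto simp: module_sum_def M.M.l_neg N.M.l_neg)
    have car: "x \<in> carrier M \<and> y \<in> carrier N" if "(x, y) \<in> H" for x y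
      using H.subset that by (auto simp: module_sum_def)
    have add: "(x \<oplus>\<^bsub>M\<^esub> x', y \<oplus>\<^bsub>N\<^esub> y') \<in> H" if "(x, y) \<in> H" "(x', y') \<in> H" for x y x' y'
      using H.m_closed[OF that] by (simp add: module_sum_def)
    have smu: "(a \<odot>\<^bsub>M\<^esub> x, a \<odot>\<^bsub>N\<^esub> y) \<in> H" if "a \<in> carrier R" "(x, y) \<in> H" for a x y
      using H.smult_closed[OF that] by (simp add: module_sum_def)
    have inv: "(\<ominus>\<^bsub>M\<^esub> x, \<ominus>\<^bsub>N\<^esub> y) \<in> H" if "(x, y) \<in> H" for x y
      using H.m_inv_closed[OF that] neg car[OF that] by simp
    have zero: "(\<zero>\<^bsub>M\<^esub>, \<zero>\<^bsub>N\<^esub>) \<in> H"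
      using H.one_closed by (simp add: module_sum_def)
    have 1: "{x. (x, \<zero>\<^bsub>N\<^esub>) \<in> H} = carrier M"
    proof (rule S(3))
      show "submodule {x. (x, \<zero>\<^bsub>N\<^esub>) \<in> H} R M"
      proof (intro submodule.intro subgroup.intro submodule_axioms.intro)
        show "inv\<^bsub>add_monoid M\<^esub> x \<in> {x. (x, \<zero>\<^bsub>N\<^esub>) \<in> H}" if "x \<in> {x. (x, \<zero>\<^bsub>N\<^esub>) \<in> H}" for x
          using inv[of x "\<zero>\<^bsub>N\<^esub>"] that by (simp add: a_inv_def[symmetric] N0)
        show "x \<otimes>\<^bsub>add_monoid M\<^esub> y \<in> {x. (x, \<zero>\<^bsub>N\<^esub>) \<in> H}"
          if "x \<in> {x. (x, \<zero>\<^bsub>N\<^esub>) \<in> H}" "y \<in> {x. (x, \<zero>\<^bsub>N\<^esub>) \<in> H}" for x y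
          using add[of x "\<zero>\<^bsub>N\<^esub>" y "\<zero>\<^bsub>N\<^esub>"] that by simp
        show "a \<odot>\<^bsub>M\<^esub> x \<in> {x. (x, \<zero>\<^bsub>N\<^esub>) \<in> H}" if "a \<in> carrier R" "x \<in> {x. (x, \<zero>\<^bsub>N\<^esub>) \<in> H}" for a x
          using smu[of a x "\<zero>\<^bsub>N\<^esub>"] that by (simp add: Nsm)
      qed (use car zero in auto)
    qed (use H(2) in auto)
    have 2: "{y. (\<zero>\<^bsub>M\<^esub>, y) \<in> H} = carrier N"
    proof (rule T(3))
      show "submodule {y. (\<zero>\<^bsub>M\<^esub>, y) \<in> H} R N"
      proof (intro submodule.intro subgroup.intro submodule_axioms.intro)
        show "inv\<^bsub>add_monoid N\<^esub> y \<in> {y. (\<zero>\<^bsub>M\<^esub>, y) \<in> H}" if "y \<in> {y. (\<zero>\<^bsub>M\<^esub>, y) \<in> H}" for y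
          using inv[of "\<zero>\<^bsub>M\<^esub>" y] that by (simp add: a_inv_def[symmetric] M0)
        show "x \<otimes>\<^bsub>add_monoid N\<^esub> y \<in> {y. (\<zero>\<^bsub>M\<^esub>, y) \<in> H}"
          if "x \<in> {y. (\<zero>\<^bsub>M\<^esub>, y) \<in> H}" "y \<in> {y. (\<zero>\<^bsub>M\<^esub>, y) \<in> H}" for x y
          using add[of "\<zero>\<^bsub>M\<^esub>" x "\<zero>\<^bsub>M\<^esub>" y] that by simp
        show "a \<odot>\<^bsub>N\<^esub> y \<in> {y. (\<zero>\<^bsub>M\<^esub>, y) \<in> H}" if "a \<in> carrier R" "y \<in> {y. (\<zero>\<^bsub>M\<^esub>, y) \<in> H}" for a y
          using smu[of a "\<zero>\<^bsub>M\<^esub>" y] that by (simp add: Msm)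
      qed (use car zero in auto)
    qed (use H(2) in auto)
    have "(x, y) \<in> H" if "x \<in> carrier M" "y \<in> carrier N" for x y
      using add[of x "\<zero>\<^bsub>N\<^esub>" "\<zero>\<^bsub>M\<^esub>" y] 1 2 that by auto
    then show ?thesis
      using car by (auto simp: module_sum_def)
  qed
  moreover have "finite ?S" "?S \<subseteq> carrier (M \<oplus>\<^sub>L N)"
    using S(1,2) T(1,2) by (auto simp: module_sum_def)
  ultimately show ?thesis
    unfolding fin_gen_module_def by (intro exI[of _ ?S] conjI allI impI) simp_all
qed

lemma G_lattice_module_sum:
  assumes "G_lattice G M" "G_lattice G N"
  shows "G_lattice G (M \<oplus>\<^sub>L N)"
proof -
  have "add_torsion_free (M \<oplus>\<^sub>L N)"
    using assms unfolding G_lattice_def add_torsion_free_def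
    by (auto simp: add_pow_module_sum) (auto simp: module_sum_def add_pow_module_sum[unfolded module_sum_def])
  then show ?thesis
    using assms by (simp add: G_lattice_def left_module_module_sum fin_gen_module_sum)
qed

context dihedral_group
begin

lemma sigma_tau_sigma: "\<sigma> \<otimes> \<tau> \<otimes> \<sigma> = \<tau>"
proof -
  have "\<tau> \<otimes> \<sigma> = inv \<sigma> \<otimes> \<tau>"
    using tau_conj by (metis inv_solve_right m_closed sigma_closed tau_closed inv_closed)
  then show ?thesis by (simp add: m_assoc) (simp add: m_assoc[symmetric])
qed

lemma sigma_pow_tau_sigma_pow: "\<sigma> [^] (i::nat) \<otimes> \<tau> \<otimes> \<sigma> [^] i = \<tau>"
proof (induction i)
  case (Suc i)
  have "\<sigma> [^] Suc i \<otimes> \<tau> \<otimes> \<sigma> [^] Suc i = \<sigma> [^] i \<otimes> (\<sigma> \<otimes> \<tau> \<otimes> \<sigma>) \<otimes> \<sigma> [^] i"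
    by (metis m_assoc m_closed nat_pow_Suc nat_pow_Suc2 nat_pow_closed sigma_closed tau_closed)
  then show ?case using Suc by (simp add: sigma_tau_sigma)
qed simp

lemma tau_sigma_pow:
  assumes "i \<le> n"
  shows "\<tau> \<otimes> \<sigma> [^] i = \<sigma> [^] (n - i) \<otimes> \<tau>"
proof -
  have "\<sigma> [^] (n - i) \<otimes> \<tau> = \<sigma> [^] (n - i) \<otimes> (\<sigma> [^] i \<otimes> \<tau> \<otimes> \<sigma> [^] i)"
    by (simp add: sigma_pow_tau_sigma_pow)
  also have "\<dots> = (\<sigma> [^] (n - i) \<otimes> \<sigma> [^] i) \<otimes> \<tau> \<otimes> \<sigma> [^] i"
    by (simp add: m_assoc)
  also have "\<dots> = \<tau> \<otimes> \<sigma> [^] i"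
    using assms by (simp add: nat_pow_mult sigma_pow_n)
  finally show ?thesis by simp
qed

definition nf :: "nat \<times> nat \<Rightarrow> 'g" where
  "nf p = \<sigma> [^] fst p \<otimes> \<tau> [^] snd p"

lemma nf_closed [simp]: "nf p \<in> carrier G"
  by (simp add: nf_def)

lemma sigma_nf: "i < n \<Longrightarrow> \<sigma> \<otimes> nf (i, e) = nf (Suc i mod n, e)"
proof (cases "Suc i = n")
  case True
  have "\<sigma> \<otimes> nf (i, e) = \<sigma> [^] Suc i \<otimes> \<tau> [^] e"
    by (simp add: nf_def m_assoc[symmetric] nat_pow_Suc2[symmetric] del: nat_pow_Suc)
  then show ?thesis using True sigma_pow_n by (simp add: nf_def del: nat_pow_Suc)
next
  case False
  assume "i < n"
  with False show ?thesis
    by (simp add: nf_def m_assoc[symmetric] nat_pow_Suc2[symmetric] del: nat_pow_Suc)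
qed

lemma tau_nf:
  assumes "i < n" "e < 2"
  shows "\<tau> \<otimes> nf (i, e) = nf ((n - i) mod n, 1 - e)"
proof -
  have "\<tau> \<otimes> nf (i, e) = \<sigma> [^] (n - i) \<otimes> (\<tau> \<otimes> \<tau> [^] e)"
    using assms by (simp add: nf_def m_assoc[symmetric] tau_sigma_pow)
  also have "\<tau> \<otimes> \<tau> [^] e = \<tau> [^] (1 - e)"
    using assms(2) tau_pow_2 by (cases e) (auto simp: numeral_2_eq_2)
  also have "\<sigma> [^] (n - i) = \<sigma> [^] ((n - i) mod n)"
    using assms sigma_pow_n by (cases "i = 0") auto
  finally show ?thesis by (simp add: nf_def)
qed

lemma dihedral_induct [consumes 2, case_names one sigma tau]:
  assumes g: "g \<in> carrier G" and n: "n > 0"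
    and one: "P \<one>"
    and sigma: "\<And>g. g \<in> carrier G \<Longrightarrow> P g \<Longrightarrow> P (\<sigma> \<otimes> g)"
    and tau: "\<And>g. g \<in> carrier G \<Longrightarrow> P g \<Longrightarrow> P (\<tau> \<otimes> g)"
  shows "P g"
proof -
  have sp: "P (\<sigma> [^] (k::nat) \<otimes> h)" if "h \<in> carrier G" "P h" for k h
  proof (induction k)
    case (Suc k)
    have "\<sigma> [^] Suc k \<otimes> h = \<sigma> \<otimes> (\<sigma> [^] k \<otimes> h)"
      using that by (subst nat_pow_Suc2) (simp_all add: m_assoc)
    then show ?case using Suc sigma that by simp
  qed (use that in simp)
  have inv_sigma: "inv \<sigma> = \<sigma> [^] (n - 1)"
    by (rule inv_equality)
       (use n sigma_pow_n in \<open>auto simp: nat_pow_Suc[symmetric] simp del: nat_pow_Suc\<close>)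
  have inv_tau: "inv \<tau> = \<tau>"
    by (rule inv_equality) (use tau_pow_2 in \<open>auto simp: numeral_2_eq_2\<close>)
  have gen: "g \<in> generate G {\<sigma>, \<tau>}" using g generated by simp
  have "\<forall>h\<in>carrier G. P h \<longrightarrow> P (g \<otimes> h)"
    using gen
  proof (induction rule: generate.induct)
    case one then show ?case by simp
  next
    case (incl h) then show ?case using sigma tau by auto
  next
    case (inv h) then show ?case using sp tau by (auto simp: inv_sigma inv_tau)
  next
    case (eng h1 h2)
    then have "h1 \<in> carrier G" "h2 \<in> carrier G" using generated by auto
    with eng show ?case by (auto simp: m_assoc)
  qed
  from this[rule_format, of \<one>] show ?thesis using one g by simp
qed

lemma nf_mem: "i < n \<Longrightarrow> e < 2 \<Longrightarrow> nf (i, e) \<in> nf ` ({..<n} \<times> {..<2})"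
  by (rule imageI) simp

lemma nf_surj:
  assumes n: "n > 0"
  shows "nf ` ({..<n} \<times> {..<2}) = carrier G"
proof
  show "carrier G \<subseteq> nf ` ({..<n} \<times> {..<2})"
  proof
    fix g assume "g \<in> carrier G"
    then show "g \<in> nf ` ({..<n} \<times> {..<2})"
      using n
    proof (induction rule: dihedral_induct)
      case one
      show ?case using nf_mem[of 0 0] n by (simp add: nf_def)
    next
      case (sigma g)
      from sigma(2) obtain p where p: "g = nf p" "p \<in> {..<n} \<times> {..<2}" by (rule imageE)
      then show ?case using n nf_mem[of "Suc (fst p) mod n" "snd p"] sigma_nf[of "fst p" "snd p"]
        by (simp add: mem_Times_iff)
    next
      case (tau g)
      from tau(2) obtain p where p: "g = nf p" "p \<in> {..<n} \<times> {..<2}" by (rule imageE)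
      then show ?case using n nf_mem[of "(n - fst p) mod n" "1 - snd p"] tau_nf[of "fst p" "snd p"]
        by (simp add: mem_Times_iff)
    qed
  qed
qed auto

lemma nf_inj:
  assumes "n > 0"
  shows "inj_on nf ({..<n} \<times> {..<2})"
proof (rule eq_card_imp_inj_on)
  show "card (nf ` ({..<n} \<times> {..<2})) = card ({..<n} \<times> {..<(2::nat)})"
    unfolding nf_surj[OF assms] using order_eq by (simp add: order_def card_cartesian_product)
qed simp

lemma dihedral_exps_nf:
  assumes "i < n" "e < 2"
  shows "dihedral_exps G n \<sigma> \<tau> (nf (i, e)) = (i, e)"
  unfolding dihedral_exps_def
proof (rule the_equality)
  fix p :: "nat \<times> nat"
  assume p: "fst p < n \<and> snd p < 2 \<and> nf (i, e) = \<sigma> [^] fst p \<otimes> \<tau> [^] snd p"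
  have "inj_on nf ({..<n} \<times> {..<2})" using assms by (intro nf_inj) simp
  moreover have "nf p = nf (i, e)" using p by (simp add: nf_def)
  ultimately show "p = (i, e)"
    by (rule inj_onD) (use p assms in \<open>simp_all add: mem_Times_iff\<close>)
qed (use assms in \<open>simp add: nf_def\<close>)

end

locale dihedral_maps = dihedral_group G n \<sigma> \<tau>
  for G :: "('g, 'm) monoid_scheme" (structure) and n \<sigma> \<tau> +
  fixes B :: "'b set" and s t :: "('b \<Rightarrow>\<^sub>0 int) \<Rightarrow> ('b \<Rightarrow>\<^sub>0 int)"
  assumes n_pos: "n > 0"
    and s_diff: "s (x - y) = s x - s y" and t_diff: "t (x - y) = t x - t y"
    and s_keys: "Poly_Mapping.keys x \<subseteq> B \<Longrightarrow> Poly_Mapping.keys (s x) \<subseteq> B"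
    and t_keys: "Poly_Mapping.keys x \<subseteq> B \<Longrightarrow> Poly_Mapping.keys (t x) \<subseteq> B"
    and s_pow_n: "Poly_Mapping.keys x \<subseteq> B \<Longrightarrow> (s ^^ n) x = x"
    and t_t: "Poly_Mapping.keys x \<subseteq> B \<Longrightarrow> t (t x) = x"
    and sts: "Poly_Mapping.keys x \<subseteq> B \<Longrightarrow> s (t (s x)) = t x"
begin

abbreviation "rep \<equiv> dihedral_rep G n \<sigma> \<tau> s t"

lemma s_pow_keys: "Poly_Mapping.keys x \<subseteq> B \<Longrightarrow> Poly_Mapping.keys ((s ^^ i) x) \<subseteq> B"
  by (induction i) (auto intro!: s_keys)

lemma t_pow_keys: "Poly_Mapping.keys x \<subseteq> B \<Longrightarrow> Poly_Mapping.keys ((t ^^ i) x) \<subseteq> B"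
  by (induction i) (auto intro!: t_keys)

lemma s_pow_diff: "(s ^^ i) (x - y) = (s ^^ i) x - (s ^^ i) y"
  by (induction i) (auto simp: s_diff)

lemma t_pow_diff: "(t ^^ i) (x - y) = (t ^^ i) x - (t ^^ i) y"
  by (induction i) (auto simp: t_diff)

lemma s_pow_t_s_pow: "Poly_Mapping.keys x \<subseteq> B \<Longrightarrow> (s ^^ i) (t ((s ^^ i) x)) = t x"
proof (induction i)
  case (Suc i)
  have "(s ^^ Suc i) (t ((s ^^ Suc i) x)) = (s ^^ i) (s (t (s ((s ^^ i) x))))"
    by (simp add: funpow_swap1)
  then show ?case using Suc by (simp add: sts s_pow_keys)
qed simp

lemma t_s_pow:
  assumes "i \<le> n" "Poly_Mapping.keys x \<subseteq> B"
  shows "t ((s ^^ i) x) = (s ^^ (n - i)) (t x)"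
proof -
  have "(s ^^ (n - i)) (t x) = (s ^^ (n - i)) ((s ^^ i) (t ((s ^^ i) x)))"
    using assms by (simp add: s_pow_t_s_pow)
  also have "\<dots> = (s ^^ (n - i + i)) (t ((s ^^ i) x))"
    by (simp only: funpow_add o_apply)
  also have "\<dots> = t ((s ^^ i) x)"
    using assms by (simp add: s_pow_n t_keys s_pow_keys)
  finally show ?thesis by simp
qed

lemma rep_nf: "i < n \<Longrightarrow> e < 2 \<Longrightarrow> rep (nf (i, e)) x = (s ^^ i) ((t ^^ e) x)"
  by (simp add: dihedral_rep_def dihedral_exps_nf)

lemma nf_cases:
  assumes "g \<in> carrier G"
  obtains i e where "i < n" "e < 2" "g = nf (i, e)"
proof -
  have "g \<in> nf ` ({..<n} \<times> {..<2})" using assms nf_surj[OF n_pos] by simp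
  then show ?thesis using that by auto
qed

lemma rep_one: "rep \<one> x = x"
  using rep_nf[of 0 0 x] n_pos by (simp add: nf_def)

lemma rep_sigma_mult:
  assumes "g \<in> carrier G" "Poly_Mapping.keys x \<subseteq> B"
  shows "rep (\<sigma> \<otimes> g) x = s (rep g x)"
proof -
  obtain i e where g: "i < n" "e < 2" "g = nf (i, e)" using nf_cases[OF assms(1)] .
  have "(s ^^ (Suc i mod n)) ((t ^^ e) x) = (s ^^ Suc i) ((t ^^ e) x)"
  proof (cases "Suc i = n")
    case True
    then show ?thesis using s_pow_n[OF t_pow_keys[OF assms(2)], of e] by (simp del: funpow.simps)
  next
    case False
    then show ?thesis using g by (simp del: funpow.simps)
  qed
  then show ?thesis using g n_pos by (simp add: sigma_nf rep_nf)
qed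

lemma rep_tau_mult:
  assumes "g \<in> carrier G" "Poly_Mapping.keys x \<subseteq> B"
  shows "rep (\<tau> \<otimes> g) x = t (rep g x)"
proof -
  obtain i e where g: "i < n" "e < 2" "g = nf (i, e)" using nf_cases[OF assms(1)] .
  have "t ((t ^^ e) x) = (t ^^ (1 - e)) x"
    using g(2) assms(2) by (cases e) (auto simp: t_t)
  moreover have "(s ^^ ((n - i) mod n)) y = (s ^^ (n - i)) y" if "Poly_Mapping.keys y \<subseteq> B" for y
    using g(1) that by (cases "i = 0") (auto simp: s_pow_n)
  ultimately show ?thesis
    using g n_pos assms(2) by (simp add: tau_nf rep_nf t_s_pow t_pow_keys)
qed

lemma rep_sigma: "Poly_Mapping.keys x \<subseteq> B \<Longrightarrow> rep \<sigma> x = s x"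
  using rep_sigma_mult[of \<one> x] by (simp add: rep_one)

lemma rep_tau: "Poly_Mapping.keys x \<subseteq> B \<Longrightarrow> rep \<tau> x = t x"
  using rep_tau_mult[of \<one> x] by (simp add: rep_one)

lemma rep_keys:
  assumes "g \<in> carrier G" "Poly_Mapping.keys x \<subseteq> B"
  shows "Poly_Mapping.keys (rep g x) \<subseteq> B"
  using assms(1) by (rule nf_cases) (simp add: rep_nf s_pow_keys t_pow_keys assms(2))

lemma add_rep_dihedral: "add_rep G B rep"
  unfolding add_rep_def
proof (intro conjI ballI allI impI)
  fix g x y assume "g \<in> carrier G"
  then show "rep g (x - y) = rep g x - rep g y"
    by (rule nf_cases) (simp add: rep_nf s_pow_diff t_pow_diff)
next
  fix g h and x :: "'b \<Rightarrow>\<^sub>0 int"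
  assume "g \<in> carrier G" and h: "h \<in> carrier G" "Poly_Mapping.keys x \<subseteq> B"
  from this(1) n_pos show "rep (g \<otimes> h) x = rep g (rep h x)"
  proof (induction rule: dihedral_induct)
    case one then show ?case using h by (simp add: rep_one)
  next
    case (sigma g)
    then show ?case using h by (simp add: m_assoc rep_sigma_mult rep_keys)
  next
    case (tau g)
    then show ?case using h by (simp add: m_assoc rep_tau_mult rep_keys)
  qed
qed (auto simp: rep_one rep_keys[THEN subsetD])

lemma smult_rep:
  assumes "Poly_Mapping.keys x \<subseteq> B"
  shows "frag_of \<sigma> \<odot>\<^bsub>rep_module B rep\<^esub> x = s x" and "frag_of \<tau> \<odot>\<^bsub>rep_module B rep\<^esub> x = t x"
  using assms by (simp_all add: rep_module_def rep_sigma rep_tau)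

end

lemma finite_M_basis: "finite (M_basis n)"
  by (simp add: M_basis_def)

lemma M_sigma_basis [simp]:
  "M_sigma n (frag_of (W i)) = frag_of (W ((i + 1) mod int n))"
  "M_sigma n (frag_of W_last) = frag_of W_last"
  by (simp_all add: M_sigma_def)

lemma M_plus_tau_basis [simp]:
  "M_plus_tau n (frag_of (W i)) = frag_of (W ((- i) mod int n))"
  "M_plus_tau n (frag_of W_last) = - frag_of W_last + (\<Sum>i\<in>{0..<int n}. frag_of (W i))"
  by (simp_all add: M_plus_tau_def)

lemma M_minus_tau_basis [simp]:
  "M_minus_tau n (frag_of (W i)) = - frag_of (W ((- i) mod int n))"
  "M_minus_tau n (frag_of W_last) = frag_of W_last - (\<Sum>i\<in>{0..<int n}. frag_of (W i))"
  by (simp_all add: M_minus_tau_def)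

lemma M_sigma_diff: "M_sigma n (x - y) = M_sigma n x - M_sigma n y"
  and M_plus_tau_diff: "M_plus_tau n (x - y) = M_plus_tau n x - M_plus_tau n y"
  and M_minus_tau_diff: "M_minus_tau n (x - y) = M_minus_tau n x - M_minus_tau n y"
  by (simp_all add: M_sigma_def M_plus_tau_def M_minus_tau_def frag_extend_diff)

lemma M_sigma_minus: "M_sigma n (- x) = - M_sigma n x"
  and M_plus_tau_minus: "M_plus_tau n (- x) = - M_plus_tau n x"
  and M_minus_tau_minus: "M_minus_tau n (- x) = - M_minus_tau n x"
  by (simp_all add: M_sigma_def M_plus_tau_def M_minus_tau_def frag_extend_minus)

lemma M_sigma_add: "M_sigma n (x + y) = M_sigma n x + M_sigma n y"
  and M_plus_tau_add: "M_plus_tau n (x + y) = M_plus_tau n x + M_plus_tau n y"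
  and M_minus_tau_add: "M_minus_tau n (x + y) = M_minus_tau n x + M_minus_tau n y"
  by (simp_all add: M_sigma_def M_plus_tau_def M_minus_tau_def frag_extend_add)

lemmas M_maps_linear = M_sigma_diff M_plus_tau_diff M_minus_tau_diff M_sigma_minus
  M_plus_tau_minus M_minus_tau_minus M_sigma_add M_plus_tau_add M_minus_tau_add

abbreviation W_sum :: "nat \<Rightarrow> M_index \<Rightarrow>\<^sub>0 int" where
  "W_sum n \<equiv> \<Sum>i\<in>{0..<int n}. frag_of (W i)"

lemma W_sum_reindex:
  assumes "\<And>i. i \<in> {0..<int n} \<Longrightarrow> f i \<in> {0..<int n} \<and> g (f i) = i"
    and "\<And>i. i \<in> {0..<int n} \<Longrightarrow> g i \<in> {0..<int n} \<and> f (g i) = i"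
  shows "(\<Sum>i\<in>{0..<int n}. frag_of (W (f i))) = W_sum n"
  by (rule sum.reindex_bij_witness[where i = g and j = f]) (use assms in auto)

lemma M_sigma_W_sum: "n > 0 \<Longrightarrow> M_sigma n (W_sum n) = W_sum n"
  using W_sum_reindex[of n "\<lambda>i. (i + 1) mod int n" "\<lambda>i. (i - 1) mod int n"]
  by (simp add: M_sigma_def frag_extend_sum mod_simps)

lemma W_sum_neg: "n > 0 \<Longrightarrow> (\<Sum>i\<in>{0..<int n}. frag_of (W ((- i) mod int n))) = W_sum n"
  using W_sum_reindex[of n "\<lambda>i. (- i) mod int n" "\<lambda>i. (- i) mod int n"]
  by (simp add: mod_simps)

lemma M_plus_tau_W_sum: "n > 0 \<Longrightarrow> M_plus_tau n (W_sum n) = W_sum n"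
  using W_sum_neg[of n] by (simp add: M_plus_tau_def frag_extend_sum)

lemma M_minus_tau_W_sum: "n > 0 \<Longrightarrow> M_minus_tau n (W_sum n) = - W_sum n"
  using W_sum_neg[of n] by (simp add: M_minus_tau_def frag_extend_sum sum_negf)

lemma keys_W_sum: "Poly_Mapping.keys (W_sum n) \<subseteq> M_basis n"
  using keys_sum[of "\<lambda>i. frag_of (W i)" "{0..<int n}"] by (auto simp: M_basis_def)

lemma M_maps_keys:
  assumes "n > 0" "Poly_Mapping.keys x \<subseteq> M_basis n"
  shows "Poly_Mapping.keys (M_sigma n x) \<subseteq> M_basis n"
    and "Poly_Mapping.keys (M_plus_tau n x) \<subseteq> M_basis n"
    and "Poly_Mapping.keys (M_minus_tau n x) \<subseteq> M_basis n"
proof -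
  have W: "W (i mod int n) \<in> M_basis n" "W_last \<in> M_basis n" for i
    using assms(1) by (auto simp: M_basis_def)
  have 1: "Poly_Mapping.keys (- frag_of W_last + W_sum n) \<subseteq> M_basis n"
    using Poly_Mapping.keys_add[of "- frag_of W_last" "W_sum n"] keys_W_sum[of n] W(2) by auto
  have 2: "Poly_Mapping.keys (frag_of W_last - W_sum n) \<subseteq> M_basis n"
    using keys_diff[of "frag_of W_last" "W_sum n"] keys_W_sum[of n] W(2) by auto
  show "Poly_Mapping.keys (M_sigma n x) \<subseteq> M_basis n"
    unfolding M_sigma_def using assms(2)
    by (intro keys_frag_extend_subset) (auto simp: W split: M_index.split)
  show "Poly_Mapping.keys (M_plus_tau n x) \<subseteq> M_basis n"
    unfolding M_plus_tau_def
  proof (rule keys_frag_extend_subset[OF _ assms(2)])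
    fix b show "Poly_Mapping.keys (case b of W i \<Rightarrow> frag_of (W (- i mod int n))
        | W_last \<Rightarrow> - frag_of W_last + W_sum n) \<subseteq> M_basis n"
      by (cases b) (use 1 W in simp_all)
  qed
  show "Poly_Mapping.keys (M_minus_tau n x) \<subseteq> M_basis n"
    unfolding M_minus_tau_def
  proof (rule keys_frag_extend_subset[OF _ assms(2)])
    fix b show "Poly_Mapping.keys (case b of W i \<Rightarrow> - frag_of (W (- i mod int n))
        | W_last \<Rightarrow> frag_of W_last - W_sum n) \<subseteq> M_basis n"
      by (cases b) (use 2 W in simp_all)
  qed
qed

lemma M_basis_cases:
  assumes "b \<in> M_basis n"
  obtains i where "b = W i" "0 \<le> i" "i < int n" | "b = W_last"
  using assms by (auto simp: M_basis_def)

lemma M_sigma_pow_n: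
  assumes "Poly_Mapping.keys x \<subseteq> M_basis n"
  shows "(M_sigma n ^^ n) x = x"
proof (rule frag_add_eqI[where B = "M_basis n" and g = "\<lambda>x. x"])
  show "(M_sigma n ^^ n) (x - y) = (M_sigma n ^^ n) x - (M_sigma n ^^ n) y" for x y
  proof -
    have "(M_sigma n ^^ k) (x - y) = (M_sigma n ^^ k) x - (M_sigma n ^^ k) y" for k
      by (induction k) (simp_all add: M_sigma_diff)
    then show ?thesis .
  qed
  show "(M_sigma n ^^ n) (frag_of b) = frag_of b" if "b \<in> M_basis n" for b
    using that
  proof (cases rule: M_basis_cases)
    case (1 i)
    then have "(M_sigma n ^^ k) (frag_of (W i)) = frag_of (W ((i + int k) mod int n))" for k
      by (induction k) (simp_all add: mod_simps ac_simps)
    then show ?thesis using 1 by simp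
  next
    case 2
    have "(M_sigma n ^^ k) (frag_of W_last) = frag_of W_last" for k
      by (induction k) simp_all
    then show ?thesis using 2 by simp
  qed
qed (use assms in auto)

lemma dihedral_maps_plus:
  assumes "dihedral_group G n \<sigma> \<tau>" "n > 0"
  shows "dihedral_maps G n \<sigma> \<tau> (M_basis n) (M_sigma n) (M_plus_tau n)"
proof (intro dihedral_maps.intro dihedral_maps_axioms.intro assms)
  fix x :: "M_index \<Rightarrow>\<^sub>0 int" assume x: "Poly_Mapping.keys x \<subseteq> M_basis n"
  show "M_plus_tau n (M_plus_tau n x) = x"
  proof (rule frag_add_eqI[where B = "M_basis n" and g = "\<lambda>x. x", OF _ _ _ x])
    show "M_plus_tau n (M_plus_tau n (frag_of b)) = frag_of b" if "b \<in> M_basis n" for b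
      using that assms(2)
      by (cases rule: M_basis_cases) (simp_all add: M_maps_linear M_plus_tau_W_sum mod_simps)
  qed (simp_all add: M_maps_linear)
  show "M_sigma n (M_plus_tau n (M_sigma n x)) = M_plus_tau n x"
  proof (rule frag_add_eqI[where B = "M_basis n", OF _ _ _ x])
    show "M_sigma n (M_plus_tau n (M_sigma n (frag_of b))) = M_plus_tau n (frag_of b)"
      if "b \<in> M_basis n" for b
      using that assms(2)
      by (cases rule: M_basis_cases) (simp_all add: M_maps_linear M_sigma_W_sum mod_simps)
  qed (simp_all add: M_maps_linear)
qed (use assms M_maps_keys M_sigma_pow_n in \<open>simp_all add: M_maps_linear\<close>)

lemma dihedral_maps_minus:
  assumes "dihedral_group G n \<sigma> \<tau>" "n > 0"
  shows "dihedral_maps G n \<sigma> \<tau> (M_basis n) (M_sigma n) (M_minus_tau n)"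
proof (intro dihedral_maps.intro dihedral_maps_axioms.intro assms)
  fix x :: "M_index \<Rightarrow>\<^sub>0 int" assume x: "Poly_Mapping.keys x \<subseteq> M_basis n"
  show "M_minus_tau n (M_minus_tau n x) = x"
  proof (rule frag_add_eqI[where B = "M_basis n" and g = "\<lambda>x. x", OF _ _ _ x])
    show "M_minus_tau n (M_minus_tau n (frag_of b)) = frag_of b" if "b \<in> M_basis n" for b
      using that assms(2)
      by (cases rule: M_basis_cases) (simp_all add: M_maps_linear M_minus_tau_W_sum mod_simps)
  qed (simp_all add: M_maps_linear)
  show "M_sigma n (M_minus_tau n (M_sigma n x)) = M_minus_tau n x"
  proof (rule frag_add_eqI[where B = "M_basis n", OF _ _ _ x])
    show "M_sigma n (M_minus_tau n (M_sigma n (frag_of b))) = M_minus_tau n (frag_of b)"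
      if "b \<in> M_basis n" for b
      using that assms(2)
      by (cases rule: M_basis_cases) (simp_all add: M_maps_linear M_sigma_W_sum mod_simps)
  qed (simp_all add: M_maps_linear)
qed (use assms M_maps_keys M_sigma_pow_n in \<open>simp_all add: M_maps_linear\<close>)

lemma (in dihedral_group) G_lattice_M:
  assumes "n > 0"
  shows "G_lattice G (M_plus G n \<sigma> \<tau>)" and "G_lattice G (M_minus G n \<sigma> \<tau>)"
proof -
  interpret p: dihedral_maps G n \<sigma> \<tau> "M_basis n" "M_sigma n" "M_plus_tau n"
    by (rule dihedral_maps_plus) (rule dihedral_group_axioms assms)+
  interpret m: dihedral_maps G n \<sigma> \<tau> "M_basis n" "M_sigma n" "M_minus_tau n"
    by (rule dihedral_maps_minus) (rule dihedral_group_axioms assms)+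
  show "G_lattice G (M_plus G n \<sigma> \<tau>)" unfolding M_plus_def
    by (rule G_lattice_rep_module[OF p.add_rep_dihedral finite_M_basis])
  show "G_lattice G (M_minus G n \<sigma> \<tau>)" unfolding M_minus_def
    by (rule G_lattice_rep_module[OF m.add_rep_dihedral finite_M_basis])
qed

text \<open>The elements \<open>\<sigma>\<close> and \<open>\<tau>\<close> of the group ring act on the bases by the defining formulas.\<close>

lemma (in dihedral_group) M_plus_action:
  assumes "n > 0"
  shows "0 \<le> i \<Longrightarrow> i < int n \<Longrightarrow>
      frag_of \<sigma> \<odot>\<^bsub>M_plus G n \<sigma> \<tau>\<^esub> frag_of (W i) = frag_of (W ((i + 1) mod int n))"
    and "0 \<le> i \<Longrightarrow> i < int n \<Longrightarrow>
      frag_of \<tau> \<odot>\<^bsub>M_plus G n \<sigma> \<tau>\<^esub> frag_of (W i) = frag_of (W ((- i) mod int n))"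
    and "frag_of \<sigma> \<odot>\<^bsub>M_plus G n \<sigma> \<tau>\<^esub> frag_of W_last = frag_of W_last"
    and "frag_of \<tau> \<odot>\<^bsub>M_plus G n \<sigma> \<tau>\<^esub> frag_of W_last = - frag_of W_last + W_sum n"
proof -
  interpret p: dihedral_maps G n \<sigma> \<tau> "M_basis n" "M_sigma n" "M_plus_tau n"
    by (rule dihedral_maps_plus) (rule dihedral_group_axioms assms)+
  note a = p.smult_rep[folded M_plus_def]
  show "0 \<le> i \<Longrightarrow> i < int n \<Longrightarrow>
      frag_of \<sigma> \<odot>\<^bsub>M_plus G n \<sigma> \<tau>\<^esub> frag_of (W i) = frag_of (W ((i + 1) mod int n))"
    by (subst a) (simp_all add: M_basis_def)
  show "0 \<le> i \<Longrightarrow> i < int n \<Longrightarrow>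
      frag_of \<tau> \<odot>\<^bsub>M_plus G n \<sigma> \<tau>\<^esub> frag_of (W i) = frag_of (W ((- i) mod int n))"
    by (subst a) (simp_all add: M_basis_def)
  show "frag_of \<sigma> \<odot>\<^bsub>M_plus G n \<sigma> \<tau>\<^esub> frag_of W_last = frag_of W_last"
    by (subst a) (simp_all add: M_basis_def)
  show "frag_of \<tau> \<odot>\<^bsub>M_plus G n \<sigma> \<tau>\<^esub> frag_of W_last = - frag_of W_last + W_sum n"
    by (subst a) (simp_all add: M_basis_def)
qed

lemma (in dihedral_group) M_minus_action:
  assumes "n > 0"
  shows "0 \<le> i \<Longrightarrow> i < int n \<Longrightarrow>
      frag_of \<sigma> \<odot>\<^bsub>M_minus G n \<sigma> \<tau>\<^esub> frag_of (W i) = frag_of (W ((i + 1) mod int n))"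
    and "0 \<le> i \<Longrightarrow> i < int n \<Longrightarrow>
      frag_of \<tau> \<odot>\<^bsub>M_minus G n \<sigma> \<tau>\<^esub> frag_of (W i) = - frag_of (W ((- i) mod int n))"
    and "frag_of \<sigma> \<odot>\<^bsub>M_minus G n \<sigma> \<tau>\<^esub> frag_of W_last = frag_of W_last"
    and "frag_of \<tau> \<odot>\<^bsub>M_minus G n \<sigma> \<tau>\<^esub> frag_of W_last = frag_of W_last - W_sum n"
proof -
  interpret m: dihedral_maps G n \<sigma> \<tau> "M_basis n" "M_sigma n" "M_minus_tau n"
    by (rule dihedral_maps_minus) (rule dihedral_group_axioms assms)+
  note a = m.smult_rep[folded M_minus_def]
  show "0 \<le> i \<Longrightarrow> i < int n \<Longrightarrow>
      frag_of \<sigma> \<odot>\<^bsub>M_minus G n \<sigma> \<tau>\<^esub> frag_of (W i) = frag_of (W ((i + 1) mod int n))"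
    by (subst a) (simp_all add: M_basis_def)
  show "0 \<le> i \<Longrightarrow> i < int n \<Longrightarrow>
      frag_of \<tau> \<odot>\<^bsub>M_minus G n \<sigma> \<tau>\<^esub> frag_of (W i) = - frag_of (W ((- i) mod int n))"
    by (subst a) (simp_all add: M_basis_def)
  show "frag_of \<sigma> \<odot>\<^bsub>M_minus G n \<sigma> \<tau>\<^esub> frag_of W_last = frag_of W_last"
    by (subst a) (simp_all add: M_basis_def)
  show "frag_of \<tau> \<odot>\<^bsub>M_minus G n \<sigma> \<tau>\<^esub> frag_of W_last = frag_of W_last - W_sum n"
    by (subst a) (simp_all add: M_basis_def)
qed

end

theory Submission
  imports Defs
begin

text \<open>Write \<open>n = 2m + 1\<close>, \<open>N = \<Sum>\<^sub>i \<sigma>\<^sup>i\<close> and \<open>\<beta> = 1 + \<sigma> + \<dots> + \<sigma>\<^sup>m\<close>; the point is that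
  \<open>\<beta> + \<beta>' = 1 + N\<close>, where \<open>\<beta>'\<close> is \<open>\<beta>\<close> with \<open>\<sigma>\<close> replaced by its inverse. Let \<open>u = (w\<^sub>0, \<beta> w\<^sub>0 - w')\<close> and
  \<open>v = (w, - m w')\<close>. Since \<open>v\<close> is fixed by \<open>\<sigma>\<close>, sending \<open>1\<close> to \<open>u\<close> and the trivial coset to \<open>v\<close> gives an
  equivariant map from the right-hand side to the left-hand side. Over \<open>\<int>[\<langle>\<sigma>\<rangle>]\<close> the system
  \<open>(a + a' \<tau>) u + (c + d \<tau>) v = (x, y)\<close> is triangular up to multiples of \<open>N\<close>, because
  \<open>\<beta> + \<beta>' - N = 1\<close> is a unit; solving it yields the inverse map explicitly.\<close>

section \<open>Sums over a period\<close>

text \<open>For a family of the form \<open>h i = \<sigma>\<^sup>i x\<close>, the three sums defined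
  here are \<open>\<sigma>\<^sup>i \<beta> x\<close>, \<open>\<sigma>\<^sup>i \<beta>' x\<close> and
  \<open>N x\<close>. Computations with these group ring elements thus become manipulations of
  indexed sums.\<close>

definition forward_sum :: "int \<Rightarrow> (int \<Rightarrow> 'a) \<Rightarrow> int \<Rightarrow> 'a::comm_monoid_add" where
  "forward_sum m h i = (\<Sum>j\<in>{0..m}. h (i + j))"

definition backward_sum :: "int \<Rightarrow> (int \<Rightarrow> 'a) \<Rightarrow> int \<Rightarrow> 'a::comm_monoid_add" where
  "backward_sum m h i = (\<Sum>j\<in>{0..m}. h (i - j))"

definition period_sum :: "nat \<Rightarrow> (int \<Rightarrow> 'a) \<Rightarrow> 'a::comm_monoid_add" where
  "period_sum n h = (\<Sum>j\<in>{0..<int n}. h j)"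

text \<open>Families indexed by residues modulo \<open>n\<close> are encoded as functions on all
  integers, so that shifting or negating an index involves no reduction.\<close>

definition periodic :: "nat \<Rightarrow> (int \<Rightarrow> 'a) \<Rightarrow> bool" where
  "periodic n h \<longleftrightarrow> (\<forall>i. h (i mod int n) = h i)"

lemma periodicD: "periodic n h \<Longrightarrow> h (i mod int n) = h i"
  by (simp add: periodic_def)

lemma periodic_cong:
  assumes "periodic n h" "i mod int n = j mod int n"
  shows "h i = h j"
  using assms periodicD by metis

lemma periodic_forward_sum: "periodic n h \<Longrightarrow> periodic n (forward_sum m h)"
  unfolding forward_sum_def
  by (subst periodic_def) (auto intro!: sum.cong elim: periodic_cong simp: mod_simps)

lemma periodic_backward_sum: "periodic n h \<Longrightarrow> periodic n (backward_sum m h)"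
  unfolding backward_sum_def
  by (subst periodic_def) (auto intro!: sum.cong elim: periodic_cong simp: mod_simps)

text \<open>Translation permutes the residues; in the group ring,
  \<open>N \<sigma>\<^sup>k = N\<close>.\<close>

lemma period_sum_shift:
  assumes "periodic n h" "n > 0"
  shows "period_sum n (\<lambda>j. h (j + k)) = period_sum n h"
  unfolding period_sum_def
  by (rule sum.reindex_bij_witness[where j = "\<lambda>j. (j + k) mod int n" and i = "\<lambda>j. (j - k) mod int n"])
     (use assms in \<open>auto simp: mod_simps periodicD\<close>)

lemma period_sum_reflect:
  assumes "periodic n h" "n > 0"
  shows "period_sum n (\<lambda>j. h (- j)) = period_sum n h"
  unfolding period_sum_def
  by (rule sum.reindex_bij_witness[where j = "\<lambda>j. (- j) mod int n" and i = "\<lambda>j. (- j) mod int n"])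
     (use assms in \<open>auto simp: mod_simps periodicD\<close>)

text \<open>The indices from \<open>i - m\<close> to \<open>i + m\<close> form one full period, and
  the two windows overlap exactly in \<open>i\<close>. This is
  \<open>\<beta> + \<beta>' = 1 + N\<close>.\<close>

lemma forward_sum_add_backward_sum:
  assumes "periodic n h" "int n = 2 * m + 1" "m \<ge> 0"
  shows "forward_sum m h i + backward_sum m h i = h i + period_sum n h"
proof -
  have n: "n > 0" using assms(2,3) by linarith
  have "h (i + (int n - j)) = h (i - j)" for j
  proof (rule periodic_cong[OF assms(1)])
    have "i + (int n - j) = (i - j) + int n" by simp
    then show "(i + (int n - j)) mod int n = (i - j) mod int n" by (simp only: mod_add_self2)
  qed
  \<comment> \<open>The map sending \<open>j\<close> to \<open>n - j\<close> carries
    \<open>1..m\<close> onto \<open>m+1..2m\<close>, the part of the period that the forward window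
    misses.\<close>
  then have "(\<Sum>j\<in>{1..m}. h (i - j)) = (\<Sum>j\<in>{m+1..<int n}. h (i + j))"
    by (intro sum.reindex_bij_witness[where j = "\<lambda>j. int n - j" and i = "\<lambda>j. int n - j"])
       (use assms(2) in auto)
  moreover have "{0..m} = insert 0 {1..m}" using assms by auto
  then have "backward_sum m h i = h i + (\<Sum>j\<in>{1..m}. h (i - j))"
    by (simp add: backward_sum_def)
  moreover have "{0..<int n} = {0..m} \<union> {m+1..<int n}" using assms by auto
  then have "(\<Sum>j\<in>{0..<int n}. h (i + j)) = forward_sum m h i + (\<Sum>j\<in>{m+1..<int n}. h (i + j))"
    unfolding forward_sum_def by (simp only:) (subst sum.union_disjoint, auto)
  moreover have "(\<Sum>j\<in>{0..<int n}. h (i + j)) = period_sum n h"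
    using period_sum_shift[OF assms(1) n, of i] by (simp add: period_sum_def add.commute)
  ultimately show ?thesis by (simp add: ac_simps)
qed

section \<open>Additive maps between free abelian groups\<close>

lemma frag_extend_sum_any: "frag_extend f (sum h A) = (\<Sum>a\<in>A. frag_extend f (h a))"
  by (cases "finite A") (simp_all add: frag_extend_sum)

lemma frag_sum_const: "(\<Sum>a\<in>A. c) = frag_cmul (int (card A)) c"
  by (induction A rule: infinite_finite_induct) (simp_all add: frag_cmul_distrib)

lemmas frag_extend_linear = frag_extend_0[where b = f for f] frag_extend_add
  frag_extend_diff frag_extend_minus frag_extend_cmul

lemma frag_extend_window_sums:
  "frag_extend f (forward_sum m h i) = forward_sum m (\<lambda>j. frag_extend f (h j)) i"
  "frag_extend f (backward_sum m h i) = backward_sum m (\<lambda>j. frag_extend f (h j)) i"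
  "frag_extend f (period_sum n h) = period_sum n (\<lambda>j. frag_extend f (h j))"
  by (simp_all add: forward_sum_def backward_sum_def period_sum_def frag_extend_sum_any)

text \<open>On a vector fixed by \<sigma>, both \<beta> and \<open>\<beta>'\<close> act as
  \<open>m + 1\<close>, the number of their terms, and \<open>N\<close> acts as
  \<open>n\<close>.\<close>

lemma window_sums_const:
  fixes c :: "'b \<Rightarrow>\<^sub>0 int"
  shows "m \<ge> 0 \<Longrightarrow> forward_sum m (\<lambda>_. c) i = frag_cmul (m + 1) c"
    and "m \<ge> 0 \<Longrightarrow> backward_sum m (\<lambda>_. c) i = frag_cmul (m + 1) c"
    and "period_sum n (\<lambda>_. c) = frag_cmul (int n) c"
  by (simp_all add: forward_sum_def backward_sum_def period_sum_def frag_sum_const)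

lemma window_sums_linear:
  fixes h k :: "int \<Rightarrow> 'a::ab_group_add"
  shows "forward_sum m (\<lambda>j. h j + k j) i = forward_sum m h i + forward_sum m k i"
    and "forward_sum m (\<lambda>j. h j - k j) i = forward_sum m h i - forward_sum m k i"
    and "backward_sum m (\<lambda>j. h j + k j) i = backward_sum m h i + backward_sum m k i"
    and "backward_sum m (\<lambda>j. h j - k j) i = backward_sum m h i - backward_sum m k i"
    and "period_sum n (\<lambda>j. h j + k j) = period_sum n h + period_sum n k"
    and "period_sum n (\<lambda>j. h j - k j) = period_sum n h - period_sum n k"
    and "period_sum n (\<lambda>j. - k j) = - period_sum n k"
  by (simp_all add: forward_sum_def backward_sum_def period_sum_def sum.distrib sum_subtractf sum_negf)

text \<open>This is \<open>N \<beta> = (m + 1) N\<close>: each of the \<open>m + 1\<close> powers of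
  \<sigma> in \<beta> is absorbed by \<open>N\<close>. The next lemma does the same for
  \<open>\<beta>'\<close>.\<close>

lemma period_sum_forward_sum:
  fixes h :: "int \<Rightarrow> 'b \<Rightarrow>\<^sub>0 int"
  assumes "periodic n h" "n > 0" "m \<ge> 0"
  shows "period_sum n (forward_sum m h) = frag_cmul (m + 1) (period_sum n h)"
proof -
  have "period_sum n (forward_sum m h) = (\<Sum>j\<in>{0..m}. period_sum n (\<lambda>i. h (i + j)))"
    unfolding period_sum_def forward_sum_def by (rule sum.swap)
  then show ?thesis using assms by (simp add: period_sum_shift frag_sum_const)
qed

lemma period_sum_backward_sum:
  fixes h :: "int \<Rightarrow> 'b \<Rightarrow>\<^sub>0 int"
  assumes "periodic n h" "n > 0" "m \<ge> 0"
  shows "period_sum n (backward_sum m h) = frag_cmul (m + 1) (period_sum n h)"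
proof -
  \<comment> \<open>The shift is written \<open>i + - j\<close> to have the additive form that
    \<open>period_sum_shift\<close> rewrites.\<close>
  have "period_sum n (backward_sum m h) = (\<Sum>j\<in>{0..m}. period_sum n (\<lambda>i. h (i + - j)))"
    unfolding period_sum_def backward_sum_def by (simp add: sum.swap[of _ "{0..m}"])
  then show ?thesis using assms by (simp only: period_sum_shift) (simp add: frag_sum_const)
qed

lemma keys_closed:
  fixes x y :: "'b \<Rightarrow>\<^sub>0 int"
  shows "Poly_Mapping.keys x \<subseteq> B \<Longrightarrow> Poly_Mapping.keys y \<subseteq> B \<Longrightarrow> Poly_Mapping.keys (x + y) \<subseteq> B"
    and "Poly_Mapping.keys x \<subseteq> B \<Longrightarrow> Poly_Mapping.keys y \<subseteq> B \<Longrightarrow> Poly_Mapping.keys (x - y) \<subseteq> B"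
    and "Poly_Mapping.keys x \<subseteq> B \<Longrightarrow> Poly_Mapping.keys (- x) \<subseteq> B"
    and "Poly_Mapping.keys x \<subseteq> B \<Longrightarrow> Poly_Mapping.keys (frag_cmul c x) \<subseteq> B"
  using Poly_Mapping.keys_add[of x y] keys_diff[of x y] keys_cmul[of c x] by auto

lemma keys_sum_closed:
  fixes h :: "'a \<Rightarrow> 'b \<Rightarrow>\<^sub>0 int"
  shows "(\<And>a. a \<in> A \<Longrightarrow> Poly_Mapping.keys (h a) \<subseteq> B) \<Longrightarrow> Poly_Mapping.keys (sum h A) \<subseteq> B"
  using keys_sum[of h A] by blast

lemma keys_window_sums_closed:
  fixes h :: "int \<Rightarrow> 'b \<Rightarrow>\<^sub>0 int"
  assumes "\<And>j. Poly_Mapping.keys (h j) \<subseteq> B"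
  shows "Poly_Mapping.keys (forward_sum m h i) \<subseteq> B"
    and "Poly_Mapping.keys (backward_sum m h i) \<subseteq> B"
    and "Poly_Mapping.keys (period_sum n h) \<subseteq> B"
  using assms by (simp_all add: forward_sum_def backward_sum_def period_sum_def keys_sum_closed)

lemma keys_additive_image:
  fixes L :: "('b \<Rightarrow>\<^sub>0 int) \<Rightarrow> ('c \<Rightarrow>\<^sub>0 int)"
  assumes L: "\<And>x y. L (x - y) = L x - L y"
    and keys: "\<And>b. b \<in> B \<Longrightarrow> Poly_Mapping.keys (L (frag_of b)) \<subseteq> C"
    and "Poly_Mapping.keys x \<subseteq> B"
  shows "Poly_Mapping.keys (L x) \<subseteq> C"
  using assms(3)
proof (induction x rule: frag_induction)
  case zero
  then show ?case using L[of 0 0] by simp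
next
  case (diff x y)
  then show ?case by (simp add: L keys_closed)
qed (rule keys)

section \<open>Homomorphisms\<close>

text \<open>Linearity over the group ring is reduced to finitely many checks in three stages:
  additivity passes from basis vectors to all \<open>x\<close>, induction on words passes from
  \<sigma> and \<tau> to all \<open>g\<close>, and additivity again passes from \<open>g\<close> to
  integer combinations of group elements.\<close>

lemma (in dihedral_group) left_module_hom_rep_module:
  assumes "n > 0" and \<rho>: "add_rep G B \<rho>" and \<kappa>: "add_rep G C \<kappa>"
    and L: "\<And>x y. L (x - y) = L x - L y"
    and keys: "\<And>b. b \<in> B \<Longrightarrow> Poly_Mapping.keys (L (frag_of b)) \<subseteq> C"
    and sigma: "\<And>b. b \<in> B \<Longrightarrow> L (\<rho> \<sigma> (frag_of b)) = \<kappa> \<sigma> (L (frag_of b))"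
    and tau: "\<And>b. b \<in> B \<Longrightarrow> L (\<rho> \<tau> (frag_of b)) = \<kappa> \<tau> (L (frag_of b))"
  shows "L \<in> left_module_hom (int_group_ring G) (rep_module B \<rho>) (rep_module C \<kappa>)"
proof -
  have add: "L (x + y) = L x + L y" for x y
    using L[of "x + y" y] by simp
  note Lkeys = keys_additive_image[OF L keys]
  have d: "\<rho> g (x - y) = \<rho> g x - \<rho> g y" "\<kappa> g (u - v) = \<kappa> g u - \<kappa> g v"
    if "g \<in> carrier G" for g x y u v
    using that \<rho> \<kappa> by (simp_all add: add_rep_def)
  have s: "L (\<rho> \<sigma> x) = \<kappa> \<sigma> (L x)" if "Poly_Mapping.keys x \<subseteq> B" for x
    by (rule frag_add_eqI[where B = B, OF _ _ _ that]) (simp_all add: L d sigma)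
  have t: "L (\<rho> \<tau> x) = \<kappa> \<tau> (L x)" if "Poly_Mapping.keys x \<subseteq> B" for x
    by (rule frag_add_eqI[where B = B, OF _ _ _ that]) (simp_all add: L d tau)
  have act: "L (\<rho> g x) = \<kappa> g (L x)" if "g \<in> carrier G" "Poly_Mapping.keys x \<subseteq> B" for g x
    using that(1) \<open>n > 0\<close>
  proof (induction rule: dihedral_induct)
    case one
    then show ?case using \<rho> \<kappa> that(2) Lkeys by (simp add: add_rep_def)
  next
    case (sigma g)
    then show ?case using \<rho> \<kappa> that(2) Lkeys s by (simp add: add_rep_def)
  next
    case (tau g)
    then show ?case using \<rho> \<kappa> that(2) Lkeys t by (simp add: add_rep_def)
  qed
  have "L (frag_extend (\<lambda>g. \<rho> g x) a) = frag_extend (\<lambda>g. \<kappa> g (L x)) a"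
    if "Poly_Mapping.keys a \<subseteq> carrier G" "Poly_Mapping.keys x \<subseteq> B" for a x
    using that by (subst add_funs_extend[OF L]) (auto intro!: frag_extend_eq simp: act)
  then show ?thesis
    using Lkeys by (simp add: left_module_hom_def rep_module_def int_group_ring_def add)
qed

text \<open>The criterion in terms of the prescribed maps \<open>s\<close> and \<open>t\<close>, so
  that no exponents of normal forms enter the equivariance checks.\<close>

lemma (in dihedral_maps) left_module_hom_dihedral_rep:
  assumes "add_rep G C \<kappa>" and "\<And>x y. L (x - y) = L x - L y"
    and "\<And>b. b \<in> B \<Longrightarrow> Poly_Mapping.keys (L (frag_of b)) \<subseteq> C"
    and "\<And>b. b \<in> B \<Longrightarrow> L (s (frag_of b)) = \<kappa> \<sigma> (L (frag_of b))"
    and "\<And>b. b \<in> B \<Longrightarrow> L (t (frag_of b)) = \<kappa> \<tau> (L (frag_of b))"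
  shows "L \<in> left_module_hom (int_group_ring G) (rep_module B rep) (rep_module C \<kappa>)"
  by (rule left_module_hom_rep_module[OF n_pos add_rep_dihedral])
     (simp_all add: assms rep_sigma rep_tau)

text \<open>The four maps are the entries of a 2 by 2 matrix. Additivity of the matrix map is the
  interchange of the inner two summands, supplied by the facts \<open>N\<close> and
  \<open>N'\<close>.\<close>

lemma left_module_hom_module_sum:
  assumes "left_module R N" "left_module R N'"
    and "P \<in> left_module_hom R M N" "Q \<in> left_module_hom R M' N"
    and "p \<in> left_module_hom R M N'" "q \<in> left_module_hom R M' N'"
  shows "(\<lambda>(x, y). (P x \<oplus>\<^bsub>N\<^esub> Q y, p x \<oplus>\<^bsub>N'\<^esub> q y)) \<in> left_module_hom R (M \<oplus>\<^sub>L M') (N \<oplus>\<^sub>L N')"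
proof -
  interpret N: left_module R N by fact
  interpret N': left_module R N' by fact
  have N: "(x \<oplus>\<^bsub>N\<^esub> y) \<oplus>\<^bsub>N\<^esub> (x' \<oplus>\<^bsub>N\<^esub> y') = (x \<oplus>\<^bsub>N\<^esub> x') \<oplus>\<^bsub>N\<^esub> (y \<oplus>\<^bsub>N\<^esub> y')"
    if "x \<in> carrier N" "y \<in> carrier N" "x' \<in> carrier N" "y' \<in> carrier N" for x y x' y'
    using that by (simp add: N.a_ac)
  have N': "(x \<oplus>\<^bsub>N'\<^esub> y) \<oplus>\<^bsub>N'\<^esub> (x' \<oplus>\<^bsub>N'\<^esub> y') = (x \<oplus>\<^bsub>N'\<^esub> x') \<oplus>\<^bsub>N'\<^esub> (y \<oplus>\<^bsub>N'\<^esub> y')"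
    if "x \<in> carrier N'" "y \<in> carrier N'" "x' \<in> carrier N'" "y' \<in> carrier N'" for x y x' y'
    using that by (simp add: N'.a_ac)
  show ?thesis
    using assms(3-6)
    by (auto simp: left_module_hom_def module_sum_def Pi_iff N.smult_r_distr N'.smult_r_distr N N')
qed

section \<open>Rotations, reflections and cosets\<close>

text \<open>Here \<open>m\<close> is an integer because it serves both as a bound of index windows
  in the integers and as a coefficient in \<open>frag_cmul\<close>.\<close>

locale odd_dihedral_group = dihedral_group G n \<sigma> \<tau>
  for G :: "('g, 'm) monoid_scheme" (structure) and n \<sigma> \<tau> +
  fixes m :: int
  assumes n_eq: "int n = 2 * m + 1" and m_nonneg: "m \<ge> 0"
begin

lemma n_pos: "n > 0"
  using n_eq m_nonneg by linarith

definition rot :: "int \<Rightarrow> 'g" where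
  "rot i = \<sigma> [^] i"

definition refl :: "int \<Rightarrow> 'g" where
  "refl i = rot i \<otimes> \<tau>"

lemma rot_mod: "rot (i mod int n) = rot i"
proof -
  have "rot (int n * (i div int n)) = \<one>"
    unfolding rot_def by (simp add: int_pow_pow[symmetric] int_pow_int sigma_pow_n)
  moreover have "rot i = rot (int n * (i div int n)) \<otimes> rot (i mod int n)"
    unfolding rot_def by (simp add: int_pow_mult[symmetric])
  ultimately show ?thesis by (simp add: rot_def)
qed

text \<open>Integer exponents are translated into normal forms, for which uniqueness of the
  exponents and multiplication by \<tau> are already established.\<close>

lemma rot_nf: "rot i = nf (nat (i mod int n), 0)"
proof -
  have "rot i = rot (int (nat (i mod int n)))" using n_pos by (simp add: rot_mod)
  then show ?thesis unfolding rot_def int_pow_int by (simp add: nf_def)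
qed

lemma refl_nf: "refl i = nf (nat (i mod int n), 1)"
  unfolding refl_def rot_nf by (simp add: nf_def)

lemma nat_mod_less: "nat (i mod int n) < n"
  using n_pos by (simp add: nat_less_iff)

lemma exps_rot: "dihedral_exps G n \<sigma> \<tau> (rot i) = (nat (i mod int n), 0)"
  and exps_refl: "dihedral_exps G n \<sigma> \<tau> (refl i) = (nat (i mod int n), 1)"
  by (simp_all add: rot_nf refl_nf dihedral_exps_nf nat_mod_less)

lemma rot_closed [simp]: "rot i \<in> carrier G" and refl_closed [simp]: "refl i \<in> carrier G"
  by (simp_all add: rot_def refl_def)

lemma sigma_rot: "\<sigma> \<otimes> rot i = rot (i + 1)"
  unfolding rot_def add.commute[of i] by (simp add: int_pow_mult)

lemma sigma_refl: "\<sigma> \<otimes> refl i = refl (i + 1)"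
  by (simp add: refl_def sigma_rot[symmetric] m_assoc)

text \<open>Matches the natural subtraction in \<open>tau_nf\<close> with negation of an integer
  exponent. The outer \<open>mod\<close> matters when \<open>n\<close> divides \<open>i\<close>:
  then \<open>n - 0\<close> must be reduced to \<open>0\<close>.\<close>

lemma nat_mod_neg: "(n - nat (i mod int n)) mod n = nat ((- i) mod int n)"
proof -
  have "int ((n - nat (i mod int n)) mod n) = (int n - i mod int n) mod int n"
    using n_pos nat_mod_less[of i] by (simp add: of_nat_diff zmod_int)
  also have "\<dots> = (- i) mod int n"
    by (simp add: mod_minus_eq)
  finally show ?thesis by (metis nat_int)
qed

lemma tau_rot: "\<tau> \<otimes> rot i = refl (- i)" and tau_refl: "\<tau> \<otimes> refl i = rot (- i)"
  by (simp_all add: rot_nf refl_nf tau_nf nat_mod_less nat_mod_neg)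

lemma carrier_cases:
  assumes "g \<in> carrier G"
  obtains i where "g = rot i" | i where "g = refl i"
proof -
  obtain i e where ie: "i < n" "e < 2" "g = nf (i, e)"
    using assms nf_surj[OF n_pos, symmetric] by auto
  then have "g = rot (int i) \<or> g = refl (int i)"
    by (cases e) (auto simp: rot_nf refl_nf)
  then show ?thesis using that by blast
qed

section \<open>The two left cosets of the rotation subgroup\<close>

abbreviation "S \<equiv> generate G {\<sigma>}"

abbreviation "S' \<equiv> \<tau> <# S"

lemma S_eq: "S = range rot"
  by (auto simp: generate_pow rot_def)

lemma lcos_range: "g <# range h = range (\<lambda>i. g \<otimes> h i)"
  by (auto simp: l_coset_def)

lemma S'_eq: "S' = range refl"
proof -
  have "S' = range (\<lambda>i. refl (- i))"
    unfolding S_eq lcos_range tau_rot ..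
  also have "\<dots> = refl ` range uminus"
    by (simp only: image_image)
  finally show ?thesis by simp
qed

text \<open>A reflection that is also a rotation would have \<tau>-exponent both 1 and 0.
  Distinctness is what allows the images of the two cosets to be prescribed independently.\<close>

lemma S'_neq_S: "S' \<noteq> S"
proof
  assume "S' = S"
  then have "refl 0 \<in> range rot" unfolding S'_eq unfolding S_eq by blast
  then obtain i where "refl 0 = rot i" by (rule rangeE)
  from arg_cong[OF this, of "dihedral_exps G n \<sigma> \<tau>"] show False
    by (simp add: exps_rot exps_refl)
qed

lemma sigma_S: "\<sigma> <# S = S" and sigma_S': "\<sigma> <# S' = S'" and tau_S': "\<tau> <# S' = S"
proof -
  have "range (\<lambda>i. h (i + 1)) = h ` range (\<lambda>i. i + 1)" for h :: "int \<Rightarrow> 'g"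
    by (simp only: image_image)
  then have "range (\<lambda>i. h (i + 1)) = range h" for h :: "int \<Rightarrow> 'g"
    by simp
  then show "\<sigma> <# S = S" "\<sigma> <# S' = S'"
    unfolding S'_eq unfolding S_eq lcos_range sigma_rot sigma_refl by simp_all
  have "range (\<lambda>i. rot (- i)) = rot ` range uminus"
    by (simp only: image_image)
  then show "\<tau> <# S' = S"
    unfolding S'_eq unfolding S_eq lcos_range tau_refl by simp
qed

text \<open>Left multiplication by \<sigma> fixes both cosets and \<tau> exchanges them, so every
  word in the generators carries \<open>S\<close> to one of the two.\<close>

lemma lcosets_S: "lcosets S = {S, S'}"
proof
  have sub: "S \<subseteq> carrier G" by (auto simp: S_eq)
  have "g <# S = S \<or> g <# S = S'" if "g \<in> carrier G" for g
    using that n_pos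
  proof (induction rule: dihedral_induct)
    case one
    show ?case using lcos_mult_one[OF sub] ..
  next
    case (sigma g)
    have "\<sigma> \<otimes> g <# S = \<sigma> <# (g <# S)"
      using sub sigma(1) by (simp add: lcos_m_assoc)
    with sigma(2) show ?case using sigma_S sigma_S' by presburger
  next
    case (tau g)
    have "\<tau> \<otimes> g <# S = \<tau> <# (g <# S)"
      using sub tau(1) by (simp add: lcos_m_assoc)
    with tau(2) show ?case using tau_S' by presburger
  qed
  then show "lcosets S \<subseteq> {S, S'}" unfolding LCOSETS_def by blast
  have "S \<in> lcosets S"
    unfolding LCOSETS_def by (rule UN_I[OF one_closed]) (simp only: lcos_mult_one[OF sub] singleton_iff)
  moreover have "S' \<in> lcosets S"
    unfolding LCOSETS_def by (rule UN_I[OF tau_closed]) (rule singletonI)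
  ultimately show "{S, S'} \<subseteq> lcosets S" by (simp only: insert_subset empty_subsetI)
qed

section \<open>The isomorphism and its inverse\<close>

definition w :: "int \<Rightarrow> M_index \<Rightarrow>\<^sub>0 int" where
  "w i = frag_of (W (i mod int n))"

abbreviation "w_last \<equiv> frag_of W_last"

abbreviation "r i \<equiv> frag_of (rot i)"

abbreviation "t i \<equiv> frag_of (refl i)"

definition from_M :: "(int \<Rightarrow> 'b \<Rightarrow>\<^sub>0 int) \<Rightarrow> ('b \<Rightarrow>\<^sub>0 int) \<Rightarrow> (M_index \<Rightarrow>\<^sub>0 int) \<Rightarrow> ('b \<Rightarrow>\<^sub>0 int)" where
  "from_M h c = frag_extend (case_M_index h c)"

text \<open>On the carrier, the families are read only at exponents from \<open>0\<close> to
  \<open>n - 1\<close>; periodicity then gives the value at every \<open>rot i\<close> and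
  \<open>refl i\<close>.\<close>

definition from_group :: "(int \<Rightarrow> 'b \<Rightarrow>\<^sub>0 int) \<Rightarrow> (int \<Rightarrow> 'b \<Rightarrow>\<^sub>0 int) \<Rightarrow> ('g \<Rightarrow>\<^sub>0 int) \<Rightarrow> ('b \<Rightarrow>\<^sub>0 int)" where
  "from_group h k = frag_extend (\<lambda>g. case dihedral_exps G n \<sigma> \<tau> g of
     (i, e) \<Rightarrow> if e = 0 then h (int i) else k (int i))"

definition from_cosets :: "('b \<Rightarrow>\<^sub>0 int) \<Rightarrow> ('b \<Rightarrow>\<^sub>0 int) \<Rightarrow> ('g set \<Rightarrow>\<^sub>0 int) \<Rightarrow> ('b \<Rightarrow>\<^sub>0 int)" where
  "from_cosets a b = frag_extend (\<lambda>C. if C = S then a else b)"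

lemma from_M_basis:
  "periodic n h \<Longrightarrow> from_M h c (w i) = h i" "from_M h c w_last = c"
  by (simp_all add: from_M_def w_def periodicD)

lemma from_group_basis:
  assumes "periodic n h" "periodic n k"
  shows "from_group h k (r i) = h i" "from_group h k (t i) = k i"
  using assms n_pos by (simp_all add: from_group_def exps_rot exps_refl periodicD)

lemma from_cosets_basis:
  "from_cosets a b (frag_of S) = a" "from_cosets a b (frag_of S') = b"
  using S'_neq_S by (simp_all add: from_cosets_def)

lemmas from_basis = from_M_basis from_group_basis from_cosets_basis

lemmas from_linear =
  frag_extend_linear[where f = "case_M_index h c" for h c, folded from_M_def]
  frag_extend_window_sums[where f = "case_M_index h c" for h c, folded from_M_def]
  frag_extend_linear[where f = "\<lambda>g. case dihedral_exps G n \<sigma> \<tau> g of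
    (i, e) \<Rightarrow> if e = 0 then h (int i) else k (int i)" for h k, folded from_group_def]
  frag_extend_window_sums[where f = "\<lambda>g. case dihedral_exps G n \<sigma> \<tau> g of
    (i, e) \<Rightarrow> if e = 0 then h (int i) else k (int i)" for h k, folded from_group_def]
  frag_extend_linear[where f = "\<lambda>C. if C = S then a else b" for a b, folded from_cosets_def]
  frag_extend_window_sums[where f = "\<lambda>C. if C = S then a else b" for a b, folded from_cosets_def]

lemma periodic_w: "periodic n w"
  and periodic_rot: "periodic n (\<lambda>i. r i)"
  and periodic_refl: "periodic n (\<lambda>i. t i)"
  by (simp_all add: periodic_def w_def rot_mod refl_def)

lemma periodic_arith:
  fixes h k :: "int \<Rightarrow> 'b::ab_group_add"
  shows "periodic n (\<lambda>_. c)" "periodic n h \<Longrightarrow> periodic n (\<lambda>i. - h i)"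
  "periodic n h \<Longrightarrow> periodic n k \<Longrightarrow> periodic n (\<lambda>i. h i + k i)"
  "periodic n h \<Longrightarrow> periodic n k \<Longrightarrow> periodic n (\<lambda>i. h i - k i)"
  by (simp_all add: periodic_def)

lemmas periodic_rules = periodic_w periodic_rot periodic_refl periodic_arith
  periodic_forward_sum periodic_backward_sum

text \<open>Back substitution from the preimages of \<open>(0, w\<^sub>0)\<close> and
  \<open>(0, w')\<close> found below. From \<open>\<tau> u = (w\<^sub>0, N w\<^sub>0 - w' - \<beta>'
  w\<^sub>0)\<close> one gets \<open>(w\<^sub>0, 0) = (\<beta>' - N + \<tau> - \<beta>' \<tau>) u +
  (1 + \<tau>) v\<close>, and from \<open>v = (w, - m w')\<close> one gets
  \<open>(w, 0) = - m N \<tau> u + (m + 1 + m \<tau>) v\<close>. The coefficients of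
  \<open>u\<close> are recorded here, those of \<open>v\<close> in the next definition.\<close>

definition plus_to_group where
  "plus_to_group = from_M (\<lambda>i. backward_sum m (\<lambda>j. r j) i - period_sum n (\<lambda>j. r j) + t i
     - backward_sum m (\<lambda>j. t j) i) (- frag_cmul m (period_sum n (\<lambda>j. t j)))"

definition plus_to_cosets where
  "plus_to_cosets = from_M (\<lambda>i. frag_of S + frag_of S')
     (frag_cmul (m + 1) (frag_of S) + frag_cmul m (frag_of S'))"

text \<open>Since \<open>\<beta> + \<beta>' - N = 1\<close>, one has
  \<open>(1 - \<tau>) u = (0, w\<^sub>0)\<close>. Since \<open>n - 2 m = 1\<close>, one has
  \<open>(1 + \<tau>) v - N \<tau> u = (0, w')\<close>. Again the coefficients of \<open>u\<close>
  come first and those of \<open>v\<close> next.\<close>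

definition minus_to_group where
  "minus_to_group = from_M (\<lambda>i. r i - t i) (- period_sum n (\<lambda>j. t j))"

definition minus_to_cosets where
  "minus_to_cosets = from_M (\<lambda>i. 0) (frag_of S + frag_of S')"

text \<open>This and the next three definitions list the components of
  \<open>\<sigma>\<^sup>i u\<close>, \<open>\<sigma>\<^sup>i \<tau> u\<close>, \<open>v\<close> and
  \<open>\<tau> v\<close>. In the minus lattice \<tau> turns \<beta> into \<open>\<beta>'\<close>
  with a sign, and \<open>w'\<close> contributes a multiple of \<open>N w\<^sub>0\<close>.\<close>

definition group_to_plus where
  "group_to_plus = from_group w w"

definition group_to_minus where
  "group_to_minus = from_group (\<lambda>i. forward_sum m w i - w_last)
     (\<lambda>i. period_sum n w - w_last - backward_sum m w i)"

definition cosets_to_plus where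
  "cosets_to_plus = from_cosets w_last (period_sum n w - w_last)"

definition cosets_to_minus where
  "cosets_to_minus = from_cosets (- frag_cmul m w_last)
     (frag_cmul m (period_sum n w) - frag_cmul m w_last)"

section \<open>The two composites on basis vectors\<close>

lemmas maps_def = plus_to_group_def plus_to_cosets_def minus_to_group_def minus_to_cosets_def
  group_to_plus_def group_to_minus_def cosets_to_plus_def cosets_to_minus_def

text \<open>The relation \<open>\<beta> + \<beta>' = 1 + N\<close> oriented as a rewrite rule:
  forward sums are eliminated, so that both sides of an identity are expressed through single terms,
  backward sums and period sums.\<close>

lemma window_sums:
  fixes h :: "int \<Rightarrow> 'b \<Rightarrow>\<^sub>0 int"
  shows "periodic n h \<Longrightarrow> forward_sum m h i = h i + period_sum n h - backward_sum m h i"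
  using forward_sum_add_backward_sum[OF _ n_eq m_nonneg, of h i] by (simp add: eq_diff_eq)

lemmas map_simps = from_basis from_linear periodic_rules window_sums window_sums_linear
  window_sums_const period_sum_forward_sum period_sum_backward_sum m_nonneg n_pos n_eq

text \<open>From here to \<open>minus_inverse\<close>, the two products of the 2 by 2 matrices of
  maps are computed entry by entry: identity on the diagonal, zero off it.\<close>

lemma group_inverse_group:
  "plus_to_group (group_to_plus (r i)) + minus_to_group (group_to_minus (r i)) = r i"
  "plus_to_group (group_to_plus (t i)) + minus_to_group (group_to_minus (t i)) = t i"
  unfolding maps_def by (simp_all add: map_simps)

lemma group_inverse_cosets:
  "plus_to_cosets (group_to_plus (r i)) + minus_to_cosets (group_to_minus (r i)) = 0"
  "plus_to_cosets (group_to_plus (t i)) + minus_to_cosets (group_to_minus (t i)) = 0"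
  unfolding maps_def by (simp_all add: map_simps)

text \<open>Multiples with coefficients depending on \<open>m\<close> survive the rewriting;
  comparing coefficients of basis vectors turns them into identities between integers.\<close>

lemma cosets_inverse:
  "plus_to_group (cosets_to_plus (frag_of S)) + minus_to_group (cosets_to_minus (frag_of S)) = 0"
  "plus_to_group (cosets_to_plus (frag_of S')) + minus_to_group (cosets_to_minus (frag_of S')) = 0"
  "plus_to_cosets (cosets_to_plus (frag_of S)) + minus_to_cosets (cosets_to_minus (frag_of S)) = frag_of S"
  "plus_to_cosets (cosets_to_plus (frag_of S')) + minus_to_cosets (cosets_to_minus (frag_of S')) = frag_of S'"
  unfolding maps_def
  by (simp_all add: map_simps)
     (rule poly_mapping_eqI, simp add: lookup_add lookup_minus algebra_simps)+

lemma plus_inverse: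
  "group_to_plus (plus_to_group (w i)) + cosets_to_plus (plus_to_cosets (w i)) = w i"
  "group_to_plus (plus_to_group w_last) + cosets_to_plus (plus_to_cosets w_last) = w_last"
  "group_to_minus (plus_to_group (w i)) + cosets_to_minus (plus_to_cosets (w i)) = 0"
  "group_to_minus (plus_to_group w_last) + cosets_to_minus (plus_to_cosets w_last) = 0"
  unfolding maps_def
  by (simp_all add: map_simps)
     (rule poly_mapping_eqI, simp add: lookup_add lookup_minus algebra_simps)+

lemma minus_inverse:
  "group_to_plus (minus_to_group (w i)) + cosets_to_plus (minus_to_cosets (w i)) = 0"
  "group_to_plus (minus_to_group w_last) + cosets_to_plus (minus_to_cosets w_last) = 0"
  "group_to_minus (minus_to_group (w i)) + cosets_to_minus (minus_to_cosets (w i)) = w i"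
  "group_to_minus (minus_to_group w_last) + cosets_to_minus (minus_to_cosets w_last) = w_last"
  unfolding maps_def
  by (simp_all add: map_simps)
     (rule poly_mapping_eqI, simp add: lookup_add lookup_minus algebra_simps)+

lemma maps_diff:
  "plus_to_group (x - y) = plus_to_group x - plus_to_group y"
  "plus_to_cosets (x - y) = plus_to_cosets x - plus_to_cosets y"
  "minus_to_group (x - y) = minus_to_group x - minus_to_group y"
  "minus_to_cosets (x - y) = minus_to_cosets x - minus_to_cosets y"
  "group_to_plus (u - v) = group_to_plus u - group_to_plus v"
  "group_to_minus (u - v) = group_to_minus u - group_to_minus v"
  "cosets_to_plus (c - d) = cosets_to_plus c - cosets_to_plus d"
  "cosets_to_minus (c - d) = cosets_to_minus c - cosets_to_minus d"
  by (simp_all add: maps_def from_linear)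

lemma maps_add:
  "plus_to_group (x + y) = plus_to_group x + plus_to_group y"
  "plus_to_cosets (x + y) = plus_to_cosets x + plus_to_cosets y"
  "minus_to_group (x + y) = minus_to_group x + minus_to_group y"
  "minus_to_cosets (x + y) = minus_to_cosets x + minus_to_cosets y"
  "group_to_plus (u + v) = group_to_plus u + group_to_plus v"
  "group_to_minus (u + v) = group_to_minus u + group_to_minus v"
  "cosets_to_plus (c + d) = cosets_to_plus c + cosets_to_plus d"
  "cosets_to_minus (c + d) = cosets_to_minus c + cosets_to_minus d"
  by (simp_all add: maps_def from_linear)

section \<open>Bases indexed by the integers, and supports\<close>

lemma M_basis_eq: "M_basis n = insert W_last (range (\<lambda>i. W (i mod int n)))"
  unfolding M_basis_def
  by (intro arg_cong[where f = "insert W_last"])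
     (auto simp: n_pos image_iff intro!: exI mod_pos_pos_trivial[symmetric])

lemma frag_of_M_basis:
  assumes "b \<in> M_basis n"
  obtains i where "frag_of b = w i" | "frag_of b = w_last"
  using assms by (auto simp: M_basis_eq w_def)

lemma frag_of_carrier:
  assumes "g \<in> carrier G"
  obtains i where "frag_of g = r i" | i where "frag_of g = t i"
  using carrier_cases[OF assms] by metis

lemma frag_of_lcosets:
  assumes "C \<in> lcosets S"
  obtains "frag_of C = frag_of S" | "frag_of C = frag_of S'"
  using assms lcosets_S by fastforce

lemma w_keys: "Poly_Mapping.keys (w i) \<subseteq> M_basis n"
  and w_last_keys: "Poly_Mapping.keys w_last \<subseteq> M_basis n"
  by (auto simp: M_basis_eq w_def)

lemma r_keys: "Poly_Mapping.keys (r i) \<subseteq> carrier G"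
  and t_keys: "Poly_Mapping.keys (t i) \<subseteq> carrier G"
  by auto

lemma S_keys: "Poly_Mapping.keys (frag_of S) \<subseteq> lcosets S"
  and S'_keys: "Poly_Mapping.keys (frag_of S') \<subseteq> lcosets S"
  unfolding lcosets_S keys_frag_of by blast+

lemmas keys_rules = keys_closed keys_window_sums_closed w_keys w_last_keys r_keys t_keys S_keys S'_keys

section \<open>Equivariance under the two generators\<close>

lemma W_sum_eq: "W_sum n = period_sum n w"
  by (simp add: period_sum_def w_def)

lemma M_action:
  "M_sigma n (w i) = w (i + 1)" "M_sigma n w_last = w_last"
  "M_plus_tau n (w i) = w (- i)" "M_plus_tau n w_last = period_sum n w - w_last"
  "M_minus_tau n (w i) = - w (- i)" "M_minus_tau n w_last = w_last - period_sum n w"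
  by (simp_all add: w_def mod_simps W_sum_eq)

text \<open>The actions get names so that they can be pushed through sums by linearity and evaluated
  only on basis vectors.\<close>

definition group_act where
  "group_act g = frag_extend (\<lambda>h. frag_of (g \<otimes> h))"

definition coset_act where
  "coset_act g = frag_extend (\<lambda>C. frag_of (g <# C))"

lemmas act_linear =
  frag_extend_linear[where f = "\<lambda>h. frag_of (g \<otimes> h)" for g, folded group_act_def]
  frag_extend_window_sums[where f = "\<lambda>h. frag_of (g \<otimes> h)" for g, folded group_act_def]
  frag_extend_linear[where f = "\<lambda>C. frag_of (g <# C)" for g, folded coset_act_def]

lemma act_basis:
  "group_act \<sigma> (r i) = r (i + 1)" "group_act \<sigma> (t i) = t (i + 1)"
  "group_act \<tau> (r i) = t (- i)" "group_act \<tau> (t i) = r (- i)"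
  "coset_act \<sigma> (frag_of S) = frag_of S" "coset_act \<sigma> (frag_of S') = frag_of S'"
  "coset_act \<tau> (frag_of S) = frag_of S'" "coset_act \<tau> (frag_of S') = frag_of S"
  by (simp_all add: group_act_def coset_act_def sigma_rot sigma_refl tau_rot tau_refl
      sigma_S sigma_S' tau_S')

text \<open>Negating the index exchanges the two windows, which is
  \<open>\<tau> \<beta> = \<beta>' \<tau>\<close>.\<close>

lemma window_sums_shift:
  "forward_sum m (\<lambda>j. h (j + k)) i = forward_sum m h (i + k)"
  "backward_sum m (\<lambda>j. h (j + k)) i = backward_sum m h (i + k)"
  "forward_sum m (\<lambda>j. h (- j)) i = backward_sum m h (- i)"
  "backward_sum m (\<lambda>j. h (- j)) i = forward_sum m h (- i)"
  unfolding forward_sum_def backward_sum_def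
  by (auto intro!: sum.cong arg_cong[where f = h])

lemmas window_sums_transformed =
  window_sums_shift[where h = "\<lambda>j. r j"] window_sums_shift[where h = "\<lambda>j. t j"]
  period_sum_shift[OF periodic_rot n_pos] period_sum_shift[OF periodic_refl n_pos]
  period_sum_reflect[OF periodic_rot n_pos] period_sum_reflect[OF periodic_refl n_pos]

text \<open>For \<sigma> every index moves by one. For \<tau> on \<open>w i\<close> the claim
  reduces to \<open>1 - \<beta> = \<beta>' - N\<close>; on \<open>w_last\<close> it follows from
  \<open>N \<beta>' = (m + 1) N\<close> and \<open>m + 1 - n = - m\<close>.\<close>

lemma plus_to_group_equivariant:
  "plus_to_group (M_sigma n (w i)) = group_act \<sigma> (plus_to_group (w i))"
  "plus_to_group (M_sigma n w_last) = group_act \<sigma> (plus_to_group w_last)"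
  "plus_to_group (M_plus_tau n (w i)) = group_act \<tau> (plus_to_group (w i))"
  "plus_to_group (M_plus_tau n w_last) = group_act \<tau> (plus_to_group w_last)"
  by (simp_all add: plus_to_group_def M_action act_basis act_linear map_simps
      window_sums_transformed del: M_plus_tau_basis M_minus_tau_basis)
     (rule poly_mapping_eqI, simp add: lookup_add lookup_minus algebra_simps)+

lemma plus_to_cosets_equivariant:
  "plus_to_cosets (M_sigma n (w i)) = coset_act \<sigma> (plus_to_cosets (w i))"
  "plus_to_cosets (M_sigma n w_last) = coset_act \<sigma> (plus_to_cosets w_last)"
  "plus_to_cosets (M_plus_tau n (w i)) = coset_act \<tau> (plus_to_cosets (w i))"
  "plus_to_cosets (M_plus_tau n w_last) = coset_act \<tau> (plus_to_cosets w_last)"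
  by (simp_all add: plus_to_cosets_def M_action act_basis act_linear map_simps
      window_sums_transformed del: M_plus_tau_basis M_minus_tau_basis)
     (rule poly_mapping_eqI, simp add: lookup_add lookup_minus algebra_simps)+

lemma minus_to_group_equivariant:
  "minus_to_group (M_sigma n (w i)) = group_act \<sigma> (minus_to_group (w i))"
  "minus_to_group (M_sigma n w_last) = group_act \<sigma> (minus_to_group w_last)"
  "minus_to_group (M_minus_tau n (w i)) = group_act \<tau> (minus_to_group (w i))"
  "minus_to_group (M_minus_tau n w_last) = group_act \<tau> (minus_to_group w_last)"
  by (simp_all add: minus_to_group_def M_action act_basis act_linear map_simps
      window_sums_transformed del: M_plus_tau_basis M_minus_tau_basis)

lemma minus_to_cosets_equivariant:
  "minus_to_cosets (M_sigma n (w i)) = coset_act \<sigma> (minus_to_cosets (w i))"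
  "minus_to_cosets (M_sigma n w_last) = coset_act \<sigma> (minus_to_cosets w_last)"
  "minus_to_cosets (M_minus_tau n (w i)) = coset_act \<tau> (minus_to_cosets (w i))"
  "minus_to_cosets (M_minus_tau n w_last) = coset_act \<tau> (minus_to_cosets w_last)"
  by (simp_all add: minus_to_cosets_def M_action act_basis act_linear map_simps
      window_sums_transformed del: M_plus_tau_basis M_minus_tau_basis)

text \<open>The homomorphism criterion takes the action axioms of its target as input, not just the
  lattice they produce.\<close>

lemma add_rep_coset_act: "add_rep G (lcosets S) coset_act"
proof -
  have sub: "S \<subseteq> carrier G" by (auto simp: S_eq)
  have cl: "g <# C \<in> lcosets S" if "g \<in> carrier G" "C \<in> lcosets S" for g C
    using that sub by (auto simp: LCOSETS_def lcos_m_assoc)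
  have assoc: "g \<otimes> h <# C = g <# (h <# C)"
    if "g \<in> carrier G" "h \<in> carrier G" "C \<in> lcosets S" for g h C
    using that sub by (auto simp: LCOSETS_def lcos_m_assoc m_assoc)
  have one: "\<one> <# C = C" if "C \<in> lcosets S" for C
    using that sub by (auto simp: LCOSETS_def lcos_m_assoc)
  have diff: "coset_act g (x - y) = coset_act g x - coset_act g y" for g x y
    by (rule act_linear)
  have basis: "coset_act g (frag_of C) = frag_of (g <# C)" for g C
    by (simp add: coset_act_def)
  show ?thesis
    unfolding add_rep_def
  proof (intro conjI ballI allI impI diff)
    fix g and x :: "'g set \<Rightarrow>\<^sub>0 int"
    assume "g \<in> carrier G" "Poly_Mapping.keys x \<subseteq> lcosets S"
    then show "Poly_Mapping.keys (coset_act g x) \<subseteq> lcosets S"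
      unfolding coset_act_def using cl by (intro keys_frag_extend_subset) auto
  next
    fix x :: "'g set \<Rightarrow>\<^sub>0 int" assume x: "Poly_Mapping.keys x \<subseteq> lcosets S"
    show "coset_act \<one> x = x"
      by (rule frag_add_eqI[where B = "lcosets S" and g = "\<lambda>x. x", OF _ _ _ x])
         (simp_all add: diff basis one)
  next
    fix g h and x :: "'g set \<Rightarrow>\<^sub>0 int"
    assume g: "g \<in> carrier G" "h \<in> carrier G" and x: "Poly_Mapping.keys x \<subseteq> lcosets S"
    show "coset_act (g \<otimes> h) x = coset_act g (coset_act h x)"
      by (rule frag_add_eqI[where B = "lcosets S", OF _ _ _ x]) (simp_all add: diff basis assoc g)
  qed
qed

lemma regular_lattice_eq: "regular_lattice G = rep_module (carrier G) group_act"
  by (simp add: regular_lattice_def group_act_def[abs_def])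

lemma perm_lattice_eq: "perm_lattice G S = rep_module (lcosets S) coset_act"
  by (simp add: perm_lattice_def coset_act_def[abs_def])

lemma add_rep_group_act: "add_rep G (carrier G) group_act"
  unfolding group_act_def[abs_def] by (rule add_rep_regular)

lemma maps_keys_basis:
  "Poly_Mapping.keys (plus_to_group (w i)) \<subseteq> carrier G"
  "Poly_Mapping.keys (plus_to_group w_last) \<subseteq> carrier G"
  "Poly_Mapping.keys (plus_to_cosets (w i)) \<subseteq> lcosets S"
  "Poly_Mapping.keys (plus_to_cosets w_last) \<subseteq> lcosets S"
  "Poly_Mapping.keys (minus_to_group (w i)) \<subseteq> carrier G"
  "Poly_Mapping.keys (minus_to_group w_last) \<subseteq> carrier G"
  "Poly_Mapping.keys (minus_to_cosets (w i)) \<subseteq> lcosets S"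
  "Poly_Mapping.keys (minus_to_cosets w_last) \<subseteq> lcosets S"
  "Poly_Mapping.keys (group_to_plus (r i)) \<subseteq> M_basis n"
  "Poly_Mapping.keys (group_to_plus (t i)) \<subseteq> M_basis n"
  "Poly_Mapping.keys (group_to_minus (r i)) \<subseteq> M_basis n"
  "Poly_Mapping.keys (group_to_minus (t i)) \<subseteq> M_basis n"
  "Poly_Mapping.keys (cosets_to_plus (frag_of S)) \<subseteq> M_basis n"
  "Poly_Mapping.keys (cosets_to_plus (frag_of S')) \<subseteq> M_basis n"
  "Poly_Mapping.keys (cosets_to_minus (frag_of S)) \<subseteq> M_basis n"
  "Poly_Mapping.keys (cosets_to_minus (frag_of S')) \<subseteq> M_basis n"
  unfolding maps_def
  by (simp_all only: from_basis periodic_rules)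
     (intro keys_rules empty_subsetI | simp only: keys_zero)+

section \<open>Linearity and inverses on the whole lattices\<close>

sublocale plus: dihedral_maps G n \<sigma> \<tau> "M_basis n" "M_sigma n" "M_plus_tau n"
  by (rule dihedral_maps_plus) (rule dihedral_group_axioms n_pos)+

sublocale minus: dihedral_maps G n \<sigma> \<tau> "M_basis n" "M_sigma n" "M_minus_tau n"
  by (rule dihedral_maps_minus) (rule dihedral_group_axioms n_pos)+

text \<open>Linearity over the group ring is established for the maps leaving the M-lattices; the
  maps back to them enter only as an additive inverse.\<close>

lemma maps_hom:
  "plus_to_group \<in> left_module_hom (int_group_ring G) (M_plus G n \<sigma> \<tau>) (regular_lattice G)"
  "plus_to_cosets \<in> left_module_hom (int_group_ring G) (M_plus G n \<sigma> \<tau>) (perm_lattice G S)"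
  "minus_to_group \<in> left_module_hom (int_group_ring G) (M_minus G n \<sigma> \<tau>) (regular_lattice G)"
  "minus_to_cosets \<in> left_module_hom (int_group_ring G) (M_minus G n \<sigma> \<tau>) (perm_lattice G S)"
proof -
  note eqs = M_plus_def M_minus_def regular_lattice_eq perm_lattice_eq
  show "plus_to_group \<in> left_module_hom (int_group_ring G) (M_plus G n \<sigma> \<tau>) (regular_lattice G)"
    unfolding eqs
    by (rule plus.left_module_hom_dihedral_rep[where L = plus_to_group, OF add_rep_group_act maps_diff(1)];
        erule frag_of_M_basis; simp only: maps_keys_basis plus_to_group_equivariant)
  show "plus_to_cosets \<in> left_module_hom (int_group_ring G) (M_plus G n \<sigma> \<tau>) (perm_lattice G S)"
    unfolding eqs
    by (rule plus.left_module_hom_dihedral_rep[where L = plus_to_cosets, OF add_rep_coset_act maps_diff(2)];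
        erule frag_of_M_basis; simp only: maps_keys_basis plus_to_cosets_equivariant)
  show "minus_to_group \<in> left_module_hom (int_group_ring G) (M_minus G n \<sigma> \<tau>) (regular_lattice G)"
    unfolding eqs
    by (rule minus.left_module_hom_dihedral_rep[where L = minus_to_group, OF add_rep_group_act maps_diff(3)];
        erule frag_of_M_basis; simp only: maps_keys_basis minus_to_group_equivariant)
  show "minus_to_cosets \<in> left_module_hom (int_group_ring G) (M_minus G n \<sigma> \<tau>) (perm_lattice G S)"
    unfolding eqs
    by (rule minus.left_module_hom_dihedral_rep[where L = minus_to_cosets, OF add_rep_coset_act maps_diff(4)];
        erule frag_of_M_basis; simp only: maps_keys_basis minus_to_cosets_equivariant)
qed

lemma maps_keys:
  "Poly_Mapping.keys u \<subseteq> carrier G \<Longrightarrow> Poly_Mapping.keys (group_to_plus u) \<subseteq> M_basis n"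
  "Poly_Mapping.keys u \<subseteq> carrier G \<Longrightarrow> Poly_Mapping.keys (group_to_minus u) \<subseteq> M_basis n"
  "Poly_Mapping.keys c \<subseteq> lcosets S \<Longrightarrow> Poly_Mapping.keys (cosets_to_plus c) \<subseteq> M_basis n"
  "Poly_Mapping.keys c \<subseteq> lcosets S \<Longrightarrow> Poly_Mapping.keys (cosets_to_minus c) \<subseteq> M_basis n"
proof -
  show "Poly_Mapping.keys (group_to_plus u) \<subseteq> M_basis n" if "Poly_Mapping.keys u \<subseteq> carrier G"
    by (rule keys_additive_image[where L = group_to_plus, OF maps_diff(5) _ that];
        erule frag_of_carrier; simp only: maps_keys_basis)
  show "Poly_Mapping.keys (group_to_minus u) \<subseteq> M_basis n" if "Poly_Mapping.keys u \<subseteq> carrier G"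
    by (rule keys_additive_image[where L = group_to_minus, OF maps_diff(6) _ that];
        erule frag_of_carrier; simp only: maps_keys_basis)
  show "Poly_Mapping.keys (cosets_to_plus c) \<subseteq> M_basis n" if "Poly_Mapping.keys c \<subseteq> lcosets S"
    by (rule keys_additive_image[where L = cosets_to_plus, OF maps_diff(7) _ that];
        erule frag_of_lcosets; simp only: maps_keys_basis)
  show "Poly_Mapping.keys (cosets_to_minus c) \<subseteq> M_basis n" if "Poly_Mapping.keys c \<subseteq> lcosets S"
    by (rule keys_additive_image[where L = cosets_to_minus, OF maps_diff(8) _ that];
        erule frag_of_lcosets; simp only: maps_keys_basis)
qed

lemma M_left_inverse:
  assumes "Poly_Mapping.keys x \<subseteq> M_basis n"
  shows "group_to_plus (plus_to_group x) + cosets_to_plus (plus_to_cosets x) = x"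
    and "group_to_minus (plus_to_group x) + cosets_to_minus (plus_to_cosets x) = 0"
    and "group_to_plus (minus_to_group x) + cosets_to_plus (minus_to_cosets x) = 0"
    and "group_to_minus (minus_to_group x) + cosets_to_minus (minus_to_cosets x) = x"
  by (rule frag_add_eqI[where B = "M_basis n", OF _ _ _ assms],
      simp_all add: maps_diff, erule frag_of_M_basis, simp_all add: plus_inverse minus_inverse)+

lemma group_right_inverse:
  assumes "Poly_Mapping.keys u \<subseteq> carrier G"
  shows "plus_to_group (group_to_plus u) + minus_to_group (group_to_minus u) = u"
    and "plus_to_cosets (group_to_plus u) + minus_to_cosets (group_to_minus u) = 0"
  by (rule frag_add_eqI[where B = "carrier G", OF _ _ _ assms],
      simp_all add: maps_diff, erule frag_of_carrier, simp_all add: group_inverse_group group_inverse_cosets)+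

lemma cosets_right_inverse:
  assumes "Poly_Mapping.keys c \<subseteq> lcosets S"
  shows "plus_to_group (cosets_to_plus c) + minus_to_group (cosets_to_minus c) = 0"
    and "plus_to_cosets (cosets_to_plus c) + minus_to_cosets (cosets_to_minus c) = c"
  by (rule frag_add_eqI[where B = "lcosets S", OF _ _ _ assms],
      simp_all add: maps_diff, erule frag_of_lcosets, simp_all add: cosets_inverse)+

section \<open>Assembly of the isomorphism\<close>

lemma finite_carrier: "finite (carrier G)"
  using order_eq n_pos by (intro order_gt_0_iff_finite[THEN iffD1]) simp

theorem M_sum_iso:
  "G_lattice_iso G (M_plus G n \<sigma> \<tau> \<oplus>\<^sub>L M_minus G n \<sigma> \<tau>) (regular_lattice G \<oplus>\<^sub>L perm_lattice G S)"
proof -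
  have lat: "G_lattice G (M_plus G n \<sigma> \<tau>)" "G_lattice G (M_minus G n \<sigma> \<tau>)"
    "G_lattice G (regular_lattice G)" "G_lattice G (perm_lattice G S)"
    using G_lattice_M[OF n_pos] G_lattice_regular[OF finite_carrier]
      G_lattice_perm[OF finite_carrier generate_is_subgroup] by simp_all
  \<comment> \<open>The sums are first taken in the target lattices, as
    \<open>left_module_hom_module_sum\<close> produces them; \<open>f_eq\<close> then replaces them
    by plain addition.\<close>
  let ?f = "\<lambda>(x, y). (plus_to_group x \<oplus>\<^bsub>regular_lattice G\<^esub> minus_to_group y,
    plus_to_cosets x \<oplus>\<^bsub>perm_lattice G S\<^esub> minus_to_cosets y)"
  \<comment> \<open>This is the map sending \<open>1\<close> to \<open>u\<close> and the trivial
    coset to \<open>v\<close>; the isomorphism \<open>?f\<close> is its inverse.\<close>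
  let ?g = "\<lambda>(u, c). (group_to_plus u + cosets_to_plus c, group_to_minus u + cosets_to_minus c)"
  let ?M = "M_plus G n \<sigma> \<tau> \<oplus>\<^sub>L M_minus G n \<sigma> \<tau>" and ?N = "regular_lattice G \<oplus>\<^sub>L perm_lattice G S"
  have hom: "?f \<in> left_module_hom (int_group_ring G) ?M ?N"
    using lat maps_hom by (intro left_module_hom_module_sum) (simp_all add: G_lattice_def)
  have carriers: "carrier ?M = {x. Poly_Mapping.keys x \<subseteq> M_basis n} \<times> {x. Poly_Mapping.keys x \<subseteq> M_basis n}"
    "carrier ?N = {u. Poly_Mapping.keys u \<subseteq> carrier G} \<times> {c. Poly_Mapping.keys c \<subseteq> lcosets S}"
    by (simp_all add: module_sum_def M_plus_def M_minus_def regular_lattice_eq perm_lattice_eq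
        rep_module_def)
  have f_eq: "?f = (\<lambda>(x, y). (plus_to_group x + minus_to_group y, plus_to_cosets x + minus_to_cosets y))"
    by (simp add: regular_lattice_eq perm_lattice_eq rep_module_def)
  have "bij_betw ?f (carrier ?M) (carrier ?N)"
  proof (rule bij_betw_byWitness[where f' = ?g])
    show "\<forall>a\<in>carrier ?M. ?g (?f a) = a"
    proof
      fix a assume "a \<in> carrier ?M"
      then obtain x y where a: "a = (x, y)"
        and xy: "Poly_Mapping.keys x \<subseteq> M_basis n" "Poly_Mapping.keys y \<subseteq> M_basis n"
        unfolding carriers by blast
      \<comment> \<open>Facts 1 to 4 are the entries of the product matrix at \<open>x\<close>, and
        5 to 8 those at \<open>y\<close>. Each component adds a diagonal entry and an off-diagonal
        zero.\<close>
      note inv = M_left_inverse[OF xy(1)] M_left_inverse[OF xy(2)]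
      have "group_to_plus (plus_to_group x + minus_to_group y) +
          cosets_to_plus (plus_to_cosets x + minus_to_cosets y) = x"
        using arg_cong2[where f = "(+)", OF inv(1) inv(7)] by (simp add: maps_add ac_simps)
      moreover have "group_to_minus (plus_to_group x + minus_to_group y) +
          cosets_to_minus (plus_to_cosets x + minus_to_cosets y) = y"
        using arg_cong2[where f = "(+)", OF inv(2) inv(8)] by (simp add: maps_add ac_simps)
      ultimately show "?g (?f a) = a" unfolding f_eq a by simp
    qed
    show "\<forall>b\<in>carrier ?N. ?f (?g b) = b"
    proof
      fix b assume "b \<in> carrier ?N"
      then obtain u c where b: "b = (u, c)"
        and uc: "Poly_Mapping.keys u \<subseteq> carrier G" "Poly_Mapping.keys c \<subseteq> lcosets S"
        unfolding carriers by blast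
      note inv = group_right_inverse[OF uc(1)] cosets_right_inverse[OF uc(2)]
      have "plus_to_group (group_to_plus u + cosets_to_plus c) +
          minus_to_group (group_to_minus u + cosets_to_minus c) = u"
        using arg_cong2[where f = "(+)", OF inv(1) inv(3)] by (simp add: maps_add ac_simps)
      moreover have "plus_to_cosets (group_to_plus u + cosets_to_plus c) +
          minus_to_cosets (group_to_minus u + cosets_to_minus c) = c"
        using arg_cong2[where f = "(+)", OF inv(2) inv(4)] by (simp add: maps_add ac_simps)
      ultimately show "?f (?g b) = b" unfolding f_eq b by simp
    qed
    show "?f ` carrier ?M \<subseteq> carrier ?N"
      using hom unfolding left_module_hom_def by (intro image_subsetI) (elim CollectE conjE funcset_mem)
    show "?g ` carrier ?N \<subseteq> carrier ?M"
    proof (rule image_subsetI)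
      fix b assume "b \<in> carrier ?N"
      then obtain u c where b: "b = (u, c)"
        and uc: "Poly_Mapping.keys u \<subseteq> carrier G" "Poly_Mapping.keys c \<subseteq> lcosets S"
        unfolding carriers by blast
      show "?g b \<in> carrier ?M"
        unfolding carriers b using uc by (simp add: keys_closed(1) maps_keys)
    qed
  qed
  with hom lat show ?thesis
    unfolding G_lattice_iso_def by (blast intro: G_lattice_module_sum)
qed

end

theorem theorem3p7:
  fixes G :: "('g, 'm) monoid_scheme" and n :: nat and \<sigma> \<tau> :: 'g
  assumes "n \<ge> 3" and "odd n"
    and "dihedral_group G n \<sigma> \<tau>"
  shows "G_lattice_iso G
           (M_plus G n \<sigma> \<tau> \<oplus>\<^sub>L M_minus G n \<sigma> \<tau>)
           (regular_lattice G \<oplus>\<^sub>L perm_lattice G (generate G {\<sigma>}))"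
proof -
  \<comment> \<open>Oddness of \<open>n\<close> supplies the half-period \<open>m\<close> as
    \<open>n div 2\<close>.\<close>
  have "int n = 2 * int (n div 2) + 1"
    using assms(2) by presburger
  then interpret odd_dihedral_group G n \<sigma> \<tau> "int (n div 2)"
    using assms(3) by (simp add: odd_dihedral_group_def odd_dihedral_group_axioms_def)
  show ?thesis by (rule M_sum_iso)
qed

end
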